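(* Let $\Phi:\mathcal A^{\mathbb L}\to\mathcal A^{\mathbb L}$ be a cellular automaton. Then $\xi_\varsigma\circ\Phi_\varsigma=\Phi\circ\xi_\varsigma$ on $\mathcal O_0$. Thus $\mathcal{QS}_\varsigma$ is a $\Phi$-invariant subset of $\mathcal A^{\mathbb L}$, and $\xi_\varsigma$ is an isomorphism from the topological dynamical system $(\mathcal O_0,d_\triangle,\Phi_\varsigma)$ to the topological dynamical system $(\mathcal{QS}_\varsigma,d_B,\Phi)$ (i.e. $\xi_\varsigma$ is a homeomorphism from $(\mathcal O_0,d_\triangle)$ onto $(\mathcal{QS}_\varsigma,d_B)$ intertwining $\Phi_\varsigma$ and $\Phi$).
   Context: Fix integers $D,K\ge1$, $\mathbb{L}=\mathbb{Z}^D$, $\mathbf{T}=(\mathbb{R}/\mathbb{Z})^K$ with Lebesgue (Haar) probability measure $\lambda$, and an injective group homomorphism $\tau:\mathbb{L}\to\mathbf{T}$ with dense image. For $\ell\in\mathbb{L}$ let $\varsigma^\ell(t)=t+\tau(\ell)$. Let $\mathcal{A}$ be a finite set. A cellular automaton is a map $\Phi:\mathcal{A}^{\mathbb{L}}\to\mathcal{A}^{\mathbb{L}}$ given by a finite $B\subset\mathbb{L}$ and a local map $\phi:\mathcal{A}^B\to\mathcal{A}$ via $\Phi(\mathbf a)_\ell=\phi([a_{\ell+b}]_{b\in B})$. An open partition is a family $\mathcal P=\{P_a\}_{a\in\mathcal A}$ of disjoint open subsets of $\mathbf T$ such that $P_*:=\bigsqcup_aP_a$ is dense and $\lambda(P_*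 )=1$; $\mathcal O$ is the set of open partitions. Put $d_\triangle(\mathcal P,\mathcal Q)=\sum_a\lambda(P_a\triangle Q_a)$; partitions at $d_\triangle$-distance $0$ are identified. For $\mathcal P\in\mathcal O$ let $\widetilde{\mathbf T}(\mathcal P)=\bigcap_{\ell}\varsigma^\ell(P_* )$ and for $t\in\widetilde{\mathbf T}(\mathcal P)$ let $\mathcal P_\varsigma(t)\in\mathcal A^{\mathbb L}$ be the sequence whose $\ell$-th entry is the unique $a$ with $\varsigma^\ell(t)\in P_a$. Let $\mathcal{QS}_\varsigma=\{\mathcal P_\varsigma(t):\mathcal P\in\mathcal O,\ t\in\widetilde{\mathbf T}(\mathcal P)\}$, $\mathcal O_0=\{\mathcal P\in\mathcal O: 0\in\widetilde{\mathbf T}(\mathcal P)\}$, and $\xi_\varsigma:\mathcal O_0\to\mathcal{QS}_\varsigma$, $\xi_\varsigma(\mathcal P)=\mathcal P_\varsigma(0)$. The induced map is $\Phi_\varsigma(\mathcal P)=\{Q_a\}_{a}$, $Q_a=\bigcup_{\mathbf c\in\mathcal A^B,\ \phi(\mathbf c)=a}\bigcap_{b\in B}\varsigma^{-b}(P_{c_b})$. The Besicovitch pseudometric on $\mathcal A^{\mathbb L}$ is $d_B(\mathbf p,\mathbf q)=\limsup_{N\to\infty}\frac{\#\{\ell\in[-N,N)^D\cap\mathbb Z^D:\ p_\ell\ne q_\ell\}}{(2N)^D}$; restricted to $\mathcal{QS}_\varsigma$ it is a metric. *)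

theory Defs
  imports "HOL-Analysis.Analysis"
begin

section \<open>The torus\<close>

quotient_type circle = real / "\<lambda>x y::real. x - y \<in> \<int>"
proof (rule equivpI)
  show "reflp (\<lambda>x y::real. x - y \<in> \<int>)"
    by (rule reflpI) simp
  show "symp (\<lambda>x y::real. x - y \<in> \<int>)"
    by (rule sympI) (metis Ints_minus minus_diff_eq)
  show "transp (\<lambda>x y::real. x - y \<in> \<int>)"
    by (rule transpI) (metis Ints_add diff_add_cancel add_diff_eq)
qed

instantiation circle :: ab_group_add
begin

lift_definition zero_circle :: circle is 0 .

lift_definition plus_circle :: "circle \<Rightarrow> circle \<Rightarrow> circle" is "(+)"
  by (metis Ints_add add_diff_add)

lift_definition uminus_circle :: "circle \<Rightarrow> circle" is uminus
  by (metis Ints_minus minus_diff_eq minus_diff_minus)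

lift_definition minus_circle :: "circle \<Rightarrow> circle \<Rightarrow> circle" is "(-)"
  by (metis Ints_diff diff_diff_eq diff_diff_eq2 add_diff_eq add.commute)

instance
  by standard (transfer; simp add: algebra_simps)+

end

text \<open>\<^const>\<open>abs_circle\<close> is the projection of the reals onto the circle; the
  topology is the quotient topology.\<close>

instantiation circle :: topological_space
begin

definition open_circle :: "circle set \<Rightarrow> bool"
  where "open_circle U \<longleftrightarrow> open (abs_circle -` U)"

instance
  by standard (auto simp: open_circle_def vimage_Union)

end

text \<open>The $K$-torus is \<^typ>\<open>circle ^ 'k\<close>, whose group structure and topology are those of
  the product.\<close>

definition torus_of :: "real ^ 'k \<Rightarrow> circle ^ 'k"
  where "torus_of x = (\<chi> i. abs_circle (x $ i))"

definition unit_cube :: "(real ^ 'k) set"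
  where "unit_cube = {x. \<forall>i. 0 \<le> x $ i \<and> x $ i < 1}"

definition haar :: "(circle ^ 'k) measure"
  where "haar = distr (restrict_space lborel unit_cube) borel torus_of"


section \<open>Cellular automata\<close>

text \<open>The configurations indexed by a finite set \<open>B\<close> are the functions that are
  \<^const>\<open>undefined\<close> outside \<open>B\<close>, that is, the elements of \<open>B \<rightarrow>\<^sub>E UNIV\<close>.  A local map is
  only ever applied to such functions.\<close>

definition cellular_automaton ::
  "(int ^ 'd) set \<Rightarrow> ((int ^ 'd \<Rightarrow> 'a) \<Rightarrow> 'a) \<Rightarrow> (int ^ 'd \<Rightarrow> 'a) \<Rightarrow> (int ^ 'd \<Rightarrow> 'a)"
  where "cellular_automaton B \<phi> p = (\<lambda>l. \<phi> (\<lambda>b\<in>B. p (l + b)))"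


section \<open>Open partitions and quasisturmian sequences\<close>

definition shift :: "(int ^ 'd \<Rightarrow> circle ^ 'k) \<Rightarrow> int ^ 'd \<Rightarrow> circle ^ 'k \<Rightarrow> circle ^ 'k"
  where "shift \<tau> l t = t + \<tau> l"

definition open_partitions :: "('a::finite \<Rightarrow> (circle ^ 'k) set) set"
  where "open_partitions = {P. (\<forall>a. open (P a)) \<and> disjoint_family P \<and>
    closure (\<Union>a. P a) = UNIV \<and> measure haar (\<Union>a. P a) = 1}"

definition d_sym ::
  "('a::finite \<Rightarrow> (circle ^ 'k) set) \<Rightarrow> ('a \<Rightarrow> (circle ^ 'k) set) \<Rightarrow> real"
  where "d_sym P Q = (\<Sum>a\<in>UNIV. measure haar (sym_diff (P a) (Q a)))"

definition generic_points ::
  "(int ^ 'd \<Rightarrow> circle ^ 'k) \<Rightarrow> ('a::finite \<Rightarrow> (circle ^ 'k) set) \<Rightarrow> (circle ^ 'k) set"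
  where "generic_points \<tau> P = (\<Inter>l. shift \<tau> l ` (\<Union>a. P a))"

definition itinerary ::
  "(int ^ 'd \<Rightarrow> circle ^ 'k) \<Rightarrow> ('a::finite \<Rightarrow> (circle ^ 'k) set) \<Rightarrow> circle ^ 'k
    \<Rightarrow> (int ^ 'd \<Rightarrow> 'a)"
  where "itinerary \<tau> P t = (\<lambda>l. THE a. shift \<tau> l t \<in> P a)"

definition quasisturmian :: "(int ^ 'd \<Rightarrow> circle ^ 'k) \<Rightarrow> (int ^ 'd \<Rightarrow> 'a::finite) set"
  where "quasisturmian \<tau> =
    {itinerary \<tau> P t | P t. P \<in> open_partitions \<and> t \<in> generic_points \<tau> P}"

definition pointed_partitions ::
  "(int ^ 'd \<Rightarrow> circle ^ 'k) \<Rightarrow> ('a::finite \<Rightarrow> (circle ^ 'k) set) set"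
  where "pointed_partitions \<tau> = {P \<in> open_partitions. 0 \<in> generic_points \<tau> P}"

definition xi ::
  "(int ^ 'd \<Rightarrow> circle ^ 'k) \<Rightarrow> ('a::finite \<Rightarrow> (circle ^ 'k) set) \<Rightarrow> (int ^ 'd \<Rightarrow> 'a)"
  where "xi \<tau> P = itinerary \<tau> P 0"

definition induced_map ::
  "(int ^ 'd \<Rightarrow> circle ^ 'k) \<Rightarrow> (int ^ 'd) set \<Rightarrow> ((int ^ 'd \<Rightarrow> 'a::finite) \<Rightarrow> 'a)
    \<Rightarrow> ('a \<Rightarrow> (circle ^ 'k) set) \<Rightarrow> ('a \<Rightarrow> (circle ^ 'k) set)"
  where "induced_map \<tau> B \<phi> P =
    (\<lambda>a. \<Union>c\<in>{c \<in> B \<rightarrow>\<^sub>E UNIV. \<phi> c = a}. \<Inter>b\<in>B. shift \<tau> (- b) ` P (c b))"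

text \<open>The limit superior is taken in the extended reals, where it always exists; the densities
  lie between 0 and 1, so it is finite.\<close>

definition besicovitch :: "(int ^ 'd \<Rightarrow> 'a) \<Rightarrow> (int ^ 'd \<Rightarrow> 'a) \<Rightarrow> real"
  where "besicovitch p q = real_of_ereal (limsup (\<lambda>N::nat. ereal (
    real (card {l::int ^ 'd. (\<forall>i. - int N \<le> l $ i \<and> l $ i < int N) \<and> p l \<noteq> q l})
      / (2 * real N) ^ CARD('d))))"


section \<open>Identification of partitions at distance zero\<close>

text \<open>The points of the metric spaces $(\mathcal{O}, d_\triangle)$ and
  $(\mathcal{O}_0, d_\triangle)$ are classes of partitions at distance zero from each other;
  a class belongs to $\mathcal{O}_0$ if one of its members does.  The lemmas
  \<open>d_sym_class\<close>, \<open>xi_class\<close> and \<open>induced_map_class\<close> below show that the maps on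
  classes do not depend on representatives.\<close>

definition part_equiv ::
  "(('a::finite \<Rightarrow> (circle ^ 'k) set) \<times> ('a \<Rightarrow> (circle ^ 'k) set)) set"
  where "part_equiv =
    {(P, Q). P \<in> open_partitions \<and> Q \<in> open_partitions \<and> d_sym P Q = 0}"

definition pointed_classes ::
  "(int ^ 'd \<Rightarrow> circle ^ 'k) \<Rightarrow> ('a::finite \<Rightarrow> (circle ^ 'k) set) set set"
  where "pointed_classes \<tau> =
    {C \<in> open_partitions // part_equiv. C \<inter> pointed_partitions \<tau> \<noteq> {}}"

text \<open>\<^locale>\<open>Metric_space\<close> requires nonnegativity and symmetry also outside the carrier;
  choosing representatives guarantees this for arbitrary arguments.\<close>

definition d_class ::
  "('a::finite \<Rightarrow> (circle ^ 'k) set) set \<Rightarrow> ('a \<Rightarrow> (circle ^ 'k) set) set \<Rightarrow> real"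
  where "d_class C D = d_sym (SOME P. P \<in> C) (SOME Q. Q \<in> D)"

definition xi_class ::
  "(int ^ 'd \<Rightarrow> circle ^ 'k) \<Rightarrow> ('a::finite \<Rightarrow> (circle ^ 'k) set) set \<Rightarrow> (int ^ 'd \<Rightarrow> 'a)"
  where "xi_class \<tau> C = the_elem (xi \<tau> ` (C \<inter> pointed_partitions \<tau>))"

definition induced_class ::
  "(int ^ 'd \<Rightarrow> circle ^ 'k) \<Rightarrow> (int ^ 'd) set \<Rightarrow> ((int ^ 'd \<Rightarrow> 'a::finite) \<Rightarrow> 'a)
    \<Rightarrow> ('a \<Rightarrow> (circle ^ 'k) set) set \<Rightarrow> ('a \<Rightarrow> (circle ^ 'k) set) set"
  where "induced_class \<tau> B \<phi> C = part_equiv `` (induced_map \<tau> B \<phi> ` C)"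


section \<open>Topological dynamical systems\<close>

definition dynamical_system :: "'x set \<Rightarrow> ('x \<Rightarrow> 'x \<Rightarrow> real) \<Rightarrow> ('x \<Rightarrow> 'x) \<Rightarrow> bool"
  where "dynamical_system X d F \<longleftrightarrow> Metric_space X d \<and>
    continuous_map (Metric_space.mtopology X d) (Metric_space.mtopology X d) F"

definition dynamical_isomorphism ::
  "'x set \<Rightarrow> ('x \<Rightarrow> 'x \<Rightarrow> real) \<Rightarrow> ('x \<Rightarrow> 'x) \<Rightarrow>
   'y set \<Rightarrow> ('y \<Rightarrow> 'y \<Rightarrow> real) \<Rightarrow> ('y \<Rightarrow> 'y) \<Rightarrow> ('x \<Rightarrow> 'y) \<Rightarrow> bool"
  where "dynamical_isomorphism X d F Y e G h \<longleftrightarrow>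
    dynamical_system X d F \<and> dynamical_system Y e G \<and>
    homeomorphic_map (Metric_space.mtopology X d) (Metric_space.mtopology Y e) h \<and>
    (\<forall>x\<in>X. h (F x) = G (h x))"


section \<open>The Haar measure\<close>

lemma abs_circle_add: "abs_circle (x + y) = abs_circle x + abs_circle y"
  by (simp add: plus_circle.abs_eq)

lemma abs_circle_eq_iff: "abs_circle x = abs_circle y \<longleftrightarrow> x - y \<in> \<int>"
  by (rule circle.abs_eq_iff)

lemma torus_of_add: "torus_of (x + y) = torus_of x + torus_of y"
  by (simp add: torus_of_def vec_eq_iff abs_circle_add)

lemma surj_torus_of: "\<exists>x. torus_of x = t"
proof -
  have "torus_of (\<chi> i. rep_circle (t $ i)) = t"
    by (simp add: torus_of_def vec_eq_iff Quotient3_abs_rep[OF Quotient3_circle])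
  then show ?thesis by blast
qed

lemma continuous_abs_circle: "continuous_on UNIV abs_circle"
  by (simp add: continuous_on_open_vimage open_circle_def)

lemma continuous_torus_of: "continuous_on UNIV (torus_of :: real ^ 'k \<Rightarrow> circle ^ 'k)"
proof -
  have "continuous_on UNIV (\<lambda>x::real^'k. abs_circle (x $ i))" for i
    by (rule continuous_on_compose2[OF continuous_abs_circle]) (auto intro: continuous_intros)
  then show ?thesis
    unfolding torus_of_def by (rule continuous_on_vec_lambda)
qed

lemma torus_of_measurable [measurable]: "torus_of \<in> borel_measurable borel"
  by (rule borel_measurable_continuous_onI[OF continuous_torus_of])

lemma continuous_circle_add: "continuous_on UNIV (\<lambda>t::circle. t + s)"
proof -
  obtain r where s: "s = abs_circle r"
    by (metis Quotient3_abs_rep[OF Quotient3_circle])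
  have "open ((\<lambda>t. t + s) -` U)" if "open U" for U :: "circle set"
  proof -
    have "abs_circle -` (\<lambda>t. t + s) -` U = (\<lambda>x. x + r) -` (abs_circle -` U)"
      by (auto simp: s abs_circle_add)
    moreover have "open ((\<lambda>x. x + r) -` (abs_circle -` U))"
      by (rule open_vimage) (use that in \<open>auto simp: open_circle_def intro: continuous_intros\<close>)
    ultimately show ?thesis by (simp add: open_circle_def)
  qed
  then show ?thesis by (simp add: continuous_on_open_vimage)
qed

lemma continuous_torus_add: "continuous_on UNIV (\<lambda>t::circle ^ 'k. t + s)"
proof -
  have "continuous_on UNIV (\<lambda>t::circle^'k. t $ i + s $ i)" for i
    by (rule continuous_on_compose2[OF continuous_circle_add]) (auto intro: continuous_intros)
  then have "continuous_on UNIV (\<lambda>t::circle^'k. \<chi> i. t $ i + s $ i)"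
    by (rule continuous_on_vec_lambda)
  moreover have "(\<lambda>t::circle^'k. \<chi> i. t $ i + s $ i) = (\<lambda>t. t + s)"
    by (simp add: fun_eq_iff vec_eq_iff)
  ultimately show ?thesis by (rule back_subst)
qed

lemma image_add_eq_vimage: "(\<lambda>t. t + s) ` U = (\<lambda>t. t + (- s)) -` U" for s :: "'g::ab_group_add"
  by (auto simp: image_iff) (metis diff_add_cancel)

lemma open_shift: "open U \<Longrightarrow> open (shift \<tau> l ` U)"
  unfolding shift_def[abs_def] image_add_eq_vimage
  by (rule open_vimage[OF _ continuous_torus_add])

lemma shift_mem_iff: "t \<in> shift \<tau> l ` U \<longleftrightarrow> t - \<tau> l \<in> U"
  unfolding shift_def[abs_def] image_add_eq_vimage by simp

lemma unit_cube_borel [measurable]: "(unit_cube :: (real ^ 'k) set) \<in> sets borel"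
proof -
  have eq: "unit_cube = (\<Inter>i\<in>UNIV. {x::real^'k. 0 \<le> x $ i} \<inter> {x. x $ i < 1})"
    by (auto simp: unit_cube_def)
  have "closed {x::real^'k. 0 \<le> x $ i}" "open {x::real^'k. x $ i < 1}" for i
    by (auto intro!: closed_Collect_le open_Collect_less continuous_intros)
  then show ?thesis
    unfolding eq by (intro sets.finite_INT sets.Int borel_closed borel_open) auto
qed

lemma sets_haar [simp, measurable_cong]: "sets haar = sets borel"
  by (simp add: haar_def)

lemma space_haar [simp]: "space haar = UNIV"
  by (simp add: haar_def)

lemma emeasure_haar:
  assumes "U \<in> sets borel"
  shows "emeasure haar U = emeasure lborel (unit_cube \<inter> torus_of -` U)"
  using assms
  by (simp add: haar_def emeasure_distr measurable_restrict_space1 space_restrict_space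
      emeasure_restrict_space Int_commute)

lemma emeasure_unit_cube: "emeasure lborel (unit_cube :: (real ^ 'k) set) = 1"
proof (rule antisym)
  have one: "(\<Prod>b\<in>(Basis :: (real^'k) set). (1::real^'k) \<bullet> b) = 1"
    by (rule prod.neutral) (auto simp: Basis_vec_def inner_axis)
  have le: "\<forall>b\<in>(Basis :: (real^'k) set). 0 \<le> (1::real^'k) \<bullet> b"
    by (auto simp: Basis_vec_def inner_axis)
  have b: "box 0 1 \<subseteq> (unit_cube :: (real ^ 'k) set)"
    by (auto simp: unit_cube_def mem_box_cart less_imp_le)
  have c: "(unit_cube :: (real ^ 'k) set) \<subseteq> cbox 0 1"
    by (auto simp: unit_cube_def mem_box_cart less_imp_le)
  show "emeasure lborel (unit_cube :: (real ^ 'k) set) \<le> 1"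
    using emeasure_mono[OF c, of lborel] le one by (simp add: emeasure_lborel_cbox_eq)
  show "1 \<le> emeasure lborel (unit_cube :: (real ^ 'k) set)"
    using emeasure_mono[OF b, of lborel] le one by (simp add: emeasure_lborel_box_eq)
qed

lemma emeasure_haar_UNIV: "emeasure haar UNIV = 1"
  by (simp add: emeasure_haar emeasure_unit_cube)

interpretation haar: finite_measure haar
  by standard (simp add: emeasure_haar_UNIV)

lemma measure_haar_UNIV: "measure haar UNIV = 1"
  by (simp add: measure_def emeasure_haar_UNIV)

definition lattice_point :: "int ^ 'k \<Rightarrow> real ^ 'k"
  where "lattice_point n = (\<chi> i. of_int (n $ i))"

lemma torus_of_lattice: "torus_of (x + lattice_point n) = torus_of x"
  by (simp add: torus_of_def lattice_point_def vec_eq_iff abs_circle_eq_iff)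

lemma unit_cube_translate: "\<exists>!n. (x :: real ^ 'k) - lattice_point n \<in> unit_cube"
proof
  show "x - lattice_point (\<chi> i. \<lfloor>x $ i\<rfloor>) \<in> unit_cube"
    by (auto simp: unit_cube_def lattice_point_def) linarith+
  fix n :: "int ^ 'k"
  assume "x - lattice_point n \<in> unit_cube"
  then have "n $ i = \<lfloor>x $ i\<rfloor>" for i
    by (auto simp: unit_cube_def lattice_point_def intro!: floor_unique[symmetric])
      (metis diff_less_eq add.commute)
  then show "n = (\<chi> i. \<lfloor>x $ i\<rfloor>)"
    by (simp add: vec_eq_iff)
qed

lemma emeasure_lborel_translate:
  fixes A :: "'e::euclidean_space set"
  assumes "A \<in> sets borel"
  shows "emeasure lborel ((\<lambda>x. x + c) -` A) = emeasure lborel A"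
proof -
  have "emeasure lborel A = emeasure (distr lborel borel ((+) c)) A"
    by (simp add: lborel_distr_plus)
  also have "\<dots> = emeasure lborel ((+) c -` A)"
    using assms by (subst emeasure_distr) auto
  also have "(+) c = (\<lambda>x. x + c)"
    by (simp add: fun_eq_iff add.commute)
  finally show ?thesis by simp
qed

lemma vimage_add_borel:
  fixes A :: "'e::euclidean_space set"
  assumes "A \<in> sets borel"
  shows "(\<lambda>x. x + c) -` A \<in> sets borel"
  using measurable_sets[OF _ assms, of "\<lambda>x. x + c" borel] by simp

lemma emeasure_fundamental_domain:
  fixes E F G :: "(real ^ 'k) set"
  assumes [measurable]: "E \<in> sets borel" "F \<in> sets borel" "G \<in> sets borel"
    and E: "\<And>x n. x + lattice_point n \<in> E \<longleftrightarrow> x \<in> E"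
    and F: "\<And>x. \<exists>!n. x + lattice_point n \<in> F"
    and G: "\<And>x. \<exists>!n. x + lattice_point n \<in> G"
  shows "emeasure lborel (E \<inter> F) = emeasure lborel (E \<inter> G)"
proof -
  have split: "emeasure lborel A =
      (\<integral>\<^sup>+n. emeasure lborel (A \<inter> (\<lambda>x. x + lattice_point n) -` H) \<partial>count_space UNIV)"
    if "A \<in> sets borel" "H \<in> sets borel" "\<And>x. \<exists>!n. x + lattice_point n \<in> H"
    for A H :: "(real ^ 'k) set"
  proof -
    have "A = (\<Union>n. A \<inter> (\<lambda>x. x + lattice_point n) -` H)"
      using ex1_implies_ex[OF that(3)] by auto
    moreover have "disjoint_family (\<lambda>n. A \<inter> (\<lambda>x. x + lattice_point n) -` H)"
      unfolding disjoint_family_on_def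
    proof (intro ballI impI equals0I)
      fix m n :: "int ^ 'k" and x
      assume "m \<noteq> n" and "x \<in> (A \<inter> (\<lambda>x. x + lattice_point m) -` H)
        \<inter> (A \<inter> (\<lambda>x. x + lattice_point n) -` H)"
      then show False
        using that(3)[of x] by (metis IntD1 IntD2 vimageD)
    qed
    ultimately show ?thesis
      using emeasure_UN_countable[of UNIV "\<lambda>n. A \<inter> (\<lambda>x. x + lattice_point n) -` H" lborel]
        that(1) vimage_add_borel[OF that(2)] by auto
  qed
  have neg: "lattice_point (- n) = - lattice_point n" for n :: "int ^ 'k"
    by (simp add: lattice_point_def vec_eq_iff)
  have "emeasure lborel (E \<inter> F) =
      (\<integral>\<^sup>+n. emeasure lborel (E \<inter> F \<inter> (\<lambda>x. x + lattice_point n) -` G) \<partial>count_space UNIV)"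
    by (rule split) (use G in auto)
  also have "\<dots> = (\<integral>\<^sup>+n. emeasure lborel (E \<inter> G \<inter> (\<lambda>x. x + lattice_point (- n)) -` F)
      \<partial>count_space UNIV)"
  proof (rule nn_integral_cong)
    fix n :: "int ^ 'k"
    have "E \<inter> F \<inter> (\<lambda>x. x + lattice_point n) -` G =
        (\<lambda>x. x + lattice_point n) -` (E \<inter> G \<inter> (\<lambda>x. x + lattice_point (- n)) -` F)"
      by (auto simp: E neg)
    then show "emeasure lborel (E \<inter> F \<inter> (\<lambda>x. x + lattice_point n) -` G) =
        emeasure lborel (E \<inter> G \<inter> (\<lambda>x. x + lattice_point (- n)) -` F)"
      using emeasure_lborel_translate[of "E \<inter> G \<inter> (\<lambda>x. x + lattice_point (- n)) -` F"]
        vimage_add_borel[of F] by simp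
  qed
  also have "\<dots> = (\<integral>\<^sup>+n. emeasure lborel (E \<inter> G \<inter> (\<lambda>x. x + lattice_point n) -` F)
      \<partial>count_space UNIV)"
    by (rule nn_integral_bij_count_space[of uminus UNIV UNIV
        "\<lambda>n. emeasure lborel (E \<inter> G \<inter> (\<lambda>x. x + lattice_point n) -` F)"])
      (rule bij_uminus)
  also have "\<dots> = emeasure lborel (E \<inter> G)"
    by (rule split[symmetric]) (use F in auto)
  finally show ?thesis .
qed

lemma unit_cube_domain: "\<exists>!n. x + lattice_point n \<in> unit_cube"
proof -
  have neg: "lattice_point (- n) = - lattice_point n" for n :: "int ^ 'k"
    by (simp add: lattice_point_def vec_eq_iff)
  show ?thesis
    using unit_cube_translate[of x] neg by (metis diff_conv_add_uminus minus_minus)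
qed

lemma emeasure_haar_translate:
  fixes U :: "(circle ^ 'k) set"
  assumes U: "U \<in> sets borel"
  shows "emeasure haar ((\<lambda>t. t + s) -` U) = emeasure haar U"
proof -
  obtain v :: "real ^ 'k" where v: "s = torus_of v"
    using surj_torus_of by metis
  let ?E = "torus_of -` U"
  let ?G = "(\<lambda>x. x - v) -` unit_cube"
  have E [measurable]: "?E \<in> sets borel"
    using measurable_sets[OF torus_of_measurable U] by simp
  have G [measurable]: "?G \<in> sets borel"
    using vimage_add_borel[OF unit_cube_borel, of "- v"] by simp
  have V: "(\<lambda>t. t + s) -` U \<in> sets borel"
    using measurable_sets[OF borel_measurable_continuous_onI[OF continuous_torus_add] U] by simp
  have eq: "unit_cube \<inter> torus_of -` ((\<lambda>t. t + s) -` U) = (\<lambda>x. x + v) -` (?E \<inter> ?G)"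
    by (auto simp: v torus_of_add)
  have "emeasure haar ((\<lambda>t. t + s) -` U) = emeasure lborel (?E \<inter> ?G)"
    by (simp only: emeasure_haar[OF V] eq) (rule emeasure_lborel_translate, use E G in blast)
  also have "\<dots> = emeasure lborel (?E \<inter> unit_cube)"
  proof (rule emeasure_fundamental_domain)
    show "\<exists>!n. x + lattice_point n \<in> ?G" for x
      using unit_cube_domain[of "x - v"] by (simp add: algebra_simps)
    show "\<exists>!n. x + lattice_point n \<in> unit_cube" for x :: "real ^ 'k"
      by (rule unit_cube_domain)
  qed (use E G in \<open>simp_all add: torus_of_lattice\<close>)
  finally show ?thesis
    by (simp add: emeasure_haar[OF U] Int_commute)
qed

lemma emeasure_haar_open_pos:
  fixes U :: "(circle ^ 'k) set"
  assumes "open U" "U \<noteq> {}"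
  shows "emeasure haar U \<noteq> 0"
proof
  assume z: "emeasure haar U = 0"
  obtain y where "torus_of y \<in> U"
    using assms(2) surj_torus_of by (metis ex_in_conv)
  moreover obtain n where "y + lattice_point n \<in> unit_cube"
    using unit_cube_domain by blast
  ultimately obtain x where x: "x \<in> unit_cube" "torus_of x \<in> U"
    by (metis torus_of_lattice)
  have op: "open (torus_of -` U)"
    by (rule open_vimage[OF assms(1) continuous_torus_of])
  have "x \<in> cbox 0 1"
    using x(1) by (auto simp: unit_cube_def mem_box_cart less_imp_le)
  then have "x \<in> closure (box 0 1)"
    by (subst closure_box) (auto simp: interval_ne_empty_cart)
  then have ne: "box 0 1 \<inter> torus_of -` U \<noteq> {}"
    using x(2) op open_Int_closure_eq_empty[of "torus_of -` U" "box 0 1"] by blast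
  have sub: "box 0 1 \<inter> torus_of -` U \<subseteq> unit_cube \<inter> torus_of -` U"
    by (auto simp: unit_cube_def mem_box_cart less_imp_le)
  have "torus_of -` U \<in> sets borel"
    using op by simp
  then have "emeasure lborel (box 0 1 \<inter> torus_of -` U) = 0"
    using emeasure_mono[OF sub, of lborel] z assms(1) by (simp add: emeasure_haar)
  moreover have "open (box 0 1 \<inter> torus_of -` U)"
    using op by auto
  moreover from this have "box 0 1 \<inter> torus_of -` U \<in> sets lborel"
    by simp
  ultimately have "negligible (box 0 1 \<inter> torus_of -` U)"
    unfolding negligible_iff_null_sets by (intro null_sets_completionI null_setsI)
  then show False
    using ne open_not_negligible \<open>open (box 0 1 \<inter> torus_of -` U)\<close> by blast
qed


section \<open>Independence of representatives\<close>

lemma open_partition_borel: "P \<in> open_partitions \<Longrightarrow> P a \<in> sets borel"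
  by (simp add: open_partitions_def)

lemma open_partition_unique:
  "P \<in> open_partitions \<Longrightarrow> t \<in> P a \<Longrightarrow> t \<in> P b \<Longrightarrow> a = b"
  unfolding open_partitions_def disjoint_family_on_def by blast

lemma d_sym_sym: "d_sym P Q = d_sym Q P"
  by (simp add: d_sym_def Un_commute)

lemma d_sym_triangle:
  assumes "P \<in> open_partitions" "Q \<in> open_partitions" "R \<in> open_partitions"
  shows "d_sym P R \<le> d_sym P Q + d_sym Q R"
proof -
  have "measure haar (sym_diff (P a) (R a)) \<le>
      measure haar (sym_diff (P a) (Q a)) + measure haar (sym_diff (Q a) (R a))" for a
  proof -
    note [measurable] = assms[THEN open_partition_borel, of a]
    have "measure haar (sym_diff (P a) (R a)) \<le>
        measure haar (sym_diff (P a) (Q a) \<union> sym_diff (Q a) (R a))"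
      by (rule haar.finite_measure_mono) auto
    also have "\<dots> \<le> measure haar (sym_diff (P a) (Q a)) + measure haar (sym_diff (Q a) (R a))"
      by (rule measure_Un_le) auto
    finally show ?thesis .
  qed
  then show ?thesis
    unfolding d_sym_def sum.distrib[symmetric] by (intro sum_mono)
qed

lemma d_sym_refl: "d_sym P P = 0"
  by (simp add: d_sym_def)

lemma d_sym_nonneg: "0 \<le> d_sym P Q"
  by (simp add: d_sym_def sum_nonneg)

lemma equiv_part_equiv: "equiv open_partitions part_equiv"
proof (rule equivI)
  show "part_equiv \<subseteq> open_partitions \<times> open_partitions"
    by (auto simp: part_equiv_def)
  show "refl_on open_partitions part_equiv"
    by (auto simp: refl_on_def part_equiv_def d_sym_refl)
  show "sym part_equiv"
    by (auto simp: sym_def part_equiv_def d_sym_sym)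
  show "trans part_equiv"
    unfolding trans_def part_equiv_def using d_sym_triangle d_sym_nonneg
    by (smt (verit) case_prodD case_prodI mem_Collect_eq)
qed

lemma d_sym_zero_iff:
  assumes P: "P \<in> open_partitions" and Q: "Q \<in> open_partitions"
  shows "d_sym P Q = 0 \<longleftrightarrow> (\<forall>a b. a \<noteq> b \<longrightarrow> P a \<inter> Q b = {})"
proof
  assume z: "d_sym P Q = 0"
  show "\<forall>a b. a \<noteq> b \<longrightarrow> P a \<inter> Q b = {}"
  proof (intro allI impI)
    fix a b :: 'a
    assume ab: "a \<noteq> b"
    note [measurable] = open_partition_borel[OF P] open_partition_borel[OF Q]
    have "measure haar (sym_diff (P a) (Q a)) = 0"
      using z by (simp add: d_sym_def sum_nonneg_eq_0_iff)
    moreover have "measure haar (P a \<inter> Q b) \<le> measure haar (sym_diff (P a) (Q a))"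
      using open_partition_unique[OF Q] ab by (intro haar.finite_measure_mono) auto
    ultimately have "emeasure haar (P a \<inter> Q b) = 0"
      using measure_nonneg[of haar "P a \<inter> Q b"] by (simp add: haar.emeasure_eq_measure)
    moreover have "open (P a \<inter> Q b)"
      using P Q by (auto simp: open_partitions_def)
    ultimately show "P a \<inter> Q b = {}"
      using emeasure_haar_open_pos by blast
  qed
next
  assume disj: "\<forall>a b. a \<noteq> b \<longrightarrow> P a \<inter> Q b = {}"
  have null: "measure haar (- (\<Union>a. R a)) = 0"
    if "R \<in> open_partitions" for R :: "'a \<Rightarrow> (circle ^ 'b) set"
  proof -
    have "(\<Union>a. R a) \<in> sets borel"
      using open_partition_borel[OF that] by auto
    then show ?thesis
      using that haar.finite_measure_compl[of "\<Union>a. R a"]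
      by (simp add: open_partitions_def Compl_eq_Diff_UNIV measure_haar_UNIV)
  qed
  have "measure haar (sym_diff (P a) (Q a)) = 0" for a
  proof -
    have U: "(\<Union>a. P a) \<in> sets borel" "(\<Union>a. Q a) \<in> sets borel"
      using open_partition_borel[OF P] open_partition_borel[OF Q] by auto
    have "measure haar (sym_diff (P a) (Q a)) \<le> measure haar (- (\<Union>a. P a) \<union> - (\<Union>a. Q a))"
    proof (rule haar.finite_measure_mono)
      show "sym_diff (P a) (Q a) \<subseteq> - (\<Union>a. P a) \<union> - (\<Union>a. Q a)"
      proof
        fix t assume t: "t \<in> sym_diff (P a) (Q a)"
        show "t \<in> - (\<Union>a. P a) \<union> - (\<Union>a. Q a)"
        proof (rule ccontr)
          assume "t \<notin> - (\<Union>a. P a) \<union> - (\<Union>a. Q a)"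
          then obtain x y where xy: "t \<in> P x" "t \<in> Q y"
            by auto
          then have "x = y"
            using disj by (metis IntI empty_iff)
          with xy t show False
            using open_partition_unique[OF P, of t a x] open_partition_unique[OF Q, of t a x] by auto
        qed
      qed
      show "- (\<Union>a. P a) \<union> - (\<Union>a. Q a) \<in> sets haar"
        unfolding sets_haar using U by (intro sets.Un borel_comp)
    qed
    also have "\<dots> \<le> measure haar (- (\<Union>a. P a)) + measure haar (- (\<Union>a. Q a))"
      by (rule measure_Un_le) (unfold sets_haar, use U in \<open>auto intro!: borel_comp simp del: Compl_UN\<close>)
    finally show ?thesis
      using null[OF P] null[OF Q] measure_nonneg[of haar "sym_diff (P a) (Q a)"] by linarith
  qed
  then show "d_sym P Q = 0"
    by (simp add: d_sym_def)
qed

lemma d_sym_class: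
  assumes "P \<in> open_partitions" "Q \<in> open_partitions"
  shows "d_class (part_equiv `` {P}) (part_equiv `` {Q}) = d_sym P Q"
proof -
  have "d_sym P' Q' = d_sym P Q" if "(P, P') \<in> part_equiv" "(Q, Q') \<in> part_equiv" for P' Q'
  proof -
    have "P' \<in> open_partitions" "Q' \<in> open_partitions" "d_sym P P' = 0" "d_sym Q Q' = 0"
      using that by (auto simp: part_equiv_def)
    then show ?thesis
      using assms d_sym_triangle[of P' P Q'] d_sym_triangle[of P Q Q'] d_sym_triangle[of P P' Q]
        d_sym_triangle[of P' Q' Q] d_sym_sym[of P P'] d_sym_sym[of Q Q'] by linarith
  qed
  moreover have "(P, SOME P'. P' \<in> part_equiv `` {P}) \<in> part_equiv"
    using someI[of "\<lambda>P'. P' \<in> part_equiv `` {P}" P] assms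
    by (simp add: part_equiv_def d_sym_refl)
  moreover have "(Q, SOME Q'. Q' \<in> part_equiv `` {Q}) \<in> part_equiv"
    using someI[of "\<lambda>Q'. Q' \<in> part_equiv `` {Q}" Q] assms
    by (simp add: part_equiv_def d_sym_refl)
  ultimately show ?thesis
    unfolding d_class_def by blast
qed

lemma generic_points_iff:
  assumes "\<And>x y. \<tau> (x + y) = \<tau> x + \<tau> y"
  shows "t \<in> generic_points \<tau> P \<longleftrightarrow> (\<forall>l. \<exists>a. t + \<tau> l \<in> P a)"
proof -
  have "\<tau> 0 = 0" using assms[of 0 0] by simp
  then have "\<tau> (- l) = - \<tau> l" for l
    using assms[of l "- l"] by (simp add: eq_neg_iff_add_eq_0 add.commute)
  then have neg: "t - \<tau> l = t + \<tau> (- l)" for l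
    by simp
  have "t \<in> generic_points \<tau> P \<longleftrightarrow> (\<forall>l. \<exists>a. t + \<tau> (- l) \<in> P a)"
    unfolding generic_points_def INT_iff shift_mem_iff neg by simp
  also have "\<dots> \<longleftrightarrow> (\<forall>l. \<exists>a. t + \<tau> l \<in> P a)"
  proof
    assume *: "\<forall>l. \<exists>a. t + \<tau> (- l) \<in> P a"
    show "\<forall>l. \<exists>a. t + \<tau> l \<in> P a"
    proof
      fix l show "\<exists>a. t + \<tau> l \<in> P a"
        using *[rule_format, of "- l"] by simp
    qed
  qed blast
  finally show ?thesis .
qed

lemma itinerary_eqI:
  "P \<in> open_partitions \<Longrightarrow> t + \<tau> l \<in> P a \<Longrightarrow> itinerary \<tau> P t l = a"
  unfolding itinerary_def shift_def by (rule the_equality) (auto dest: open_partition_unique)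

lemma xi_class:
  assumes hom: "\<And>x y. \<tau> (x + y) = \<tau> x + \<tau> y" and P: "P \<in> pointed_partitions \<tau>"
  shows "xi_class \<tau> (part_equiv `` {P}) = xi \<tau> P"
proof -
  have PO: "P \<in> open_partitions" and P0: "\<And>l. \<exists>a. \<tau> l \<in> P a"
    using P generic_points_iff[of \<tau> 0 P, OF hom] by (auto simp: pointed_partitions_def)
  have "xi \<tau> Q = xi \<tau> P" if "(P, Q) \<in> part_equiv" "Q \<in> pointed_partitions \<tau>" for Q
  proof
    fix l
    have QO: "Q \<in> open_partitions" and Q0: "\<exists>a. \<tau> l \<in> Q a"
      using that(2) generic_points_iff[of \<tau> 0 Q, OF hom] by (auto simp: pointed_partitions_def)
    obtain a b where ab: "\<tau> l \<in> P a" "\<tau> l \<in> Q b"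
      using P0 Q0 by blast
    then have "a = b"
      using that(1) d_sym_zero_iff[OF PO QO] by (auto simp: part_equiv_def)
    then show "xi \<tau> Q l = xi \<tau> P l"
      using ab itinerary_eqI[OF PO, of 0 \<tau> l a] itinerary_eqI[OF QO, of 0 \<tau> l b]
      by (simp add: xi_def)
  qed
  then have "xi \<tau> ` (part_equiv `` {P} \<inter> pointed_partitions \<tau>) \<subseteq> {xi \<tau> P}"
    by blast
  moreover have "P \<in> part_equiv `` {P} \<inter> pointed_partitions \<tau>"
    using PO P by (simp add: part_equiv_def d_sym_refl)
  ultimately have "xi \<tau> ` (part_equiv `` {P} \<inter> pointed_partitions \<tau>) = {xi \<tau> P}"
    by blast
  then show ?thesis by (simp add: xi_class_def)
qed

lemma induced_map_iff:
  assumes "\<And>x y. \<tau> (x + y) = \<tau> x + \<tau> y"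
  shows "t \<in> induced_map \<tau> B \<phi> P a \<longleftrightarrow>
    (\<exists>c\<in>B \<rightarrow>\<^sub>E UNIV. \<phi> c = a \<and> (\<forall>b\<in>B. t + \<tau> b \<in> P (c b)))"
proof -
  have "\<tau> 0 = 0" using assms[of 0 0] by simp
  then have "\<tau> (- l) = - \<tau> l" for l
    using assms[of l "- l"] by (simp add: eq_neg_iff_add_eq_0 add.commute)
  then show ?thesis
    by (auto simp: induced_map_def shift_mem_iff)
qed

lemma induced_map_open_partition:
  fixes \<tau> :: "int ^ 'd \<Rightarrow> circle ^ 'k" and P :: "'a::finite \<Rightarrow> (circle ^ 'k) set"
  assumes hom: "\<And>x y. \<tau> (x + y) = \<tau> x + \<tau> y" and B: "finite B"
    and P: "P \<in> open_partitions"
  shows "induced_map \<tau> B \<phi> P \<in> open_partitions"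
proof -
  let ?Q = "induced_map \<tau> B \<phi> P"
  have op: "open (?Q a)" for a
    unfolding induced_map_def
    using P B by (intro open_UN ballI open_INT open_shift) (auto simp: open_partitions_def)
  have disj: "disjoint_family ?Q"
    unfolding disjoint_family_on_def
  proof (intro ballI impI)
    fix a b :: 'a
    assume ab: "a \<noteq> b"
    { fix t assume t: "t \<in> ?Q a" "t \<in> ?Q b"
      then obtain c c' where c: "c \<in> B \<rightarrow>\<^sub>E UNIV" "\<phi> c = a" "\<forall>b\<in>B. t + \<tau> b \<in> P (c b)"
        and c': "c' \<in> B \<rightarrow>\<^sub>E UNIV" "\<phi> c' = b" "\<forall>b\<in>B. t + \<tau> b \<in> P (c' b)"
        unfolding induced_map_iff[OF hom] by blast
      have "c = c'"
        by (rule PiE_ext[OF c(1) c'(1)]) (use c(3) c'(3) open_partition_unique[OF P] in blast)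
      with c c' ab have False by simp }
    then show "?Q a \<inter> ?Q b = {}" by blast
  qed
  have star: "(\<Inter>b\<in>B. (\<lambda>t. t + \<tau> b) -` (\<Union>a. P a)) \<subseteq> (\<Union>a. ?Q a)"
  proof
    fix t assume "t \<in> (\<Inter>b\<in>B. (\<lambda>t. t + \<tau> b) -` (\<Union>a. P a))"
    then obtain f where f: "\<forall>b\<in>B. t + \<tau> b \<in> P (f b)"
      by simp metis
    then have "t \<in> ?Q (\<phi> (restrict f B))"
      unfolding induced_map_iff[OF hom] by (intro bexI[of _ "restrict f B"]) auto
    then show "t \<in> (\<Union>a. ?Q a)" by blast
  qed
  have PU: "(\<Union>a. P a) \<in> sets borel"
    using open_partition_borel[OF P] by auto
  have mU: "(\<Union>a. ?Q a) \<in> sets borel"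
    using op by auto
  have ae: "AE t in haar. \<forall>b\<in>B. t + \<tau> b \<in> (\<Union>a. P a)"
  proof (subst AE_finite_all[OF B], intro ballI)
    fix b
    let ?V = "(\<lambda>t. t + \<tau> b) -` (\<Union>a. P a)"
    have V: "?V \<in> sets borel"
      using measurable_sets[OF borel_measurable_continuous_onI[OF continuous_torus_add] PU] by simp
    have "emeasure haar ?V = emeasure haar (\<Union>a. P a)"
      by (rule emeasure_haar_translate[OF PU])
    then have "measure haar ?V = 1"
      using P by (simp add: measure_def open_partitions_def)
    then have "measure haar (- ?V) = 0"
      using haar.finite_measure_compl[of ?V] V
      by (simp add: Compl_eq_Diff_UNIV measure_haar_UNIV)
    then have "- ?V \<in> null_sets haar"
      using V by (auto simp: null_sets_def haar.emeasure_eq_measure)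
    then show "AE t in haar. t + \<tau> b \<in> (\<Union>a. P a)"
      by (rule AE_I') auto
  qed
  have aeQ: "AE t in haar. t \<in> (\<Union>a. ?Q a) \<longleftrightarrow> t \<in> UNIV"
    using ae
  proof (rule eventually_mono)
    fix t assume "\<forall>b\<in>B. t + \<tau> b \<in> (\<Union>a. P a)"
    then have "t \<in> (\<Inter>b\<in>B. (\<lambda>t. t + \<tau> b) -` (\<Union>a. P a))"
      by simp
    then show "t \<in> (\<Union>a. ?Q a) \<longleftrightarrow> t \<in> UNIV"
      using subsetD[OF star] by simp
  qed
  have "emeasure haar (\<Union>a. ?Q a) = emeasure haar (UNIV :: (circle ^ 'k) set)"
  proof (rule emeasure_eq_AE)
    show "AE t in haar. t \<in> (\<Union>a. ?Q a) \<longleftrightarrow> t \<in> UNIV"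
      by (fact aeQ)
  qed (use mU in simp_all)
  then have m: "measure haar (\<Union>a. ?Q a) = 1"
    by (simp add: measure_def emeasure_haar_UNIV)
  have "closure (\<Union>a. ?Q a) = UNIV"
  proof (rule ccontr)
    let ?W = "- closure (\<Union>a. ?Q a)"
    assume "closure (\<Union>a. ?Q a) \<noteq> UNIV"
    then have W: "?W \<noteq> {}"
      by blast
    have "AE t in haar. t \<notin> ?W"
      using aeQ by (rule eventually_mono) (simp add: subsetD[OF closure_subset])
    moreover have "?W \<in> sets haar"
      by (simp add: borel_open)
    ultimately have "emeasure haar ?W = 0"
      using AE_iff_measurable[of ?W haar "\<lambda>t. t \<notin> ?W"] by (auto simp: Collect_neg_eq)
    then show False
      using emeasure_haar_open_pos[of ?W] W open_Compl[OF closed_closure] by blast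
  qed
  with op disj m show ?thesis
    by (simp add: open_partitions_def)
qed

lemma induced_map_class:
  fixes \<tau> :: "int ^ 'd \<Rightarrow> circle ^ 'k" and P :: "'a::finite \<Rightarrow> (circle ^ 'k) set"
  assumes hom: "\<And>x y. \<tau> (x + y) = \<tau> x + \<tau> y" and B: "finite B"
    and P: "P \<in> open_partitions"
  shows "induced_class \<tau> B \<phi> (part_equiv `` {P}) = part_equiv `` {induced_map \<tau> B \<phi> P}"
proof -
  have resp: "(induced_map \<tau> B \<phi> P, induced_map \<tau> B \<phi> Q) \<in> part_equiv"
    if "(P, Q) \<in> part_equiv" for Q
  proof -
    have Q: "Q \<in> open_partitions" and z: "d_sym P Q = 0"
      using that by (auto simp: part_equiv_def)
    have IP: "induced_map \<tau> B \<phi> P \<in> open_partitions"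
      by (rule induced_map_open_partition) fact+
    have IQ: "induced_map \<tau> B \<phi> Q \<in> open_partitions"
      by (rule induced_map_open_partition) fact+
    have "induced_map \<tau> B \<phi> P a \<inter> induced_map \<tau> B \<phi> Q b = {}" if ab: "a \<noteq> b" for a b
    proof -
      { fix t assume "t \<in> induced_map \<tau> B \<phi> P a" "t \<in> induced_map \<tau> B \<phi> Q b"
        then obtain c c' where c: "c \<in> B \<rightarrow>\<^sub>E UNIV" "\<phi> c = a" "\<forall>b\<in>B. t + \<tau> b \<in> P (c b)"
          and c': "c' \<in> B \<rightarrow>\<^sub>E UNIV" "\<phi> c' = b" "\<forall>b\<in>B. t + \<tau> b \<in> Q (c' b)"
          unfolding induced_map_iff[OF hom] by blast
        have "c = c'"
          by (rule PiE_ext[OF c(1) c'(1)]) (use c(3) c'(3) z d_sym_zero_iff[OF P Q] in blast)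
        with c c' ab have False by simp }
      then show ?thesis by blast
    qed
    then show ?thesis
      using IP IQ d_sym_zero_iff[OF IP IQ] by (auto simp: part_equiv_def)
  qed
  have "(P, P) \<in> part_equiv"
    using P by (auto simp: part_equiv_def d_sym_refl)
  then show ?thesis
    unfolding induced_class_def
    using resp equiv_class_eq[OF equiv_part_equiv] by blast
qed

end

theory Submission
  imports Defs
begin

text \<open>
  The intertwining relation is a matter of unfolding: if \<open>0\<close> is generic for \<open>P\<close>, the cell of the
  induced partition that contains \<open>\<tau> l\<close> is read off from the cells of \<open>P\<close> that contain the points
  \<open>\<tau> (l + b)\<close> (\<open>xi_induced_map\<close>).  The substance is that \<open>\<xi>\<close> is a homeomorphism, and it is one
  because it is a similarity: the Besicovitch distance of the sequences of \<open>P\<close> and \<open>Q\<close> is exactly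
  half of the distance \<^const>\<open>d_sym\<close> of \<open>P\<close> and \<open>Q\<close>.

  To see this, let \<open>D\<close> be the union of the sets \<open>P a \<inter> Q b\<close> with \<open>a \<noteq> b\<close>, and \<open>A\<close> the union of the
  sets \<open>P a \<inter> Q a\<close>.  The two sequences differ at \<open>l\<close> if and only if \<open>\<tau> l \<in> D\<close>, so their distance
  is the upper frequency of visits to \<open>D\<close>, while \<open>d_sym P Q\<close> is twice the measure of \<open>D\<close>
  (\<open>d_sym_eq_disagreement\<close>).  Equidistribution of the orbit gives, for every open set, that the
  lower frequency of visits is at least its measure (\<open>visit_frequency_lower_bound\<close>).  Now \<open>A\<close> and
  \<open>D\<close> are disjoint and open, the orbit never leaves \<open>A \<union> D\<close>, and the measures of \<open>A\<close> and \<open>D\<close> add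
  up to 1.  The lower bounds for both sets therefore force the frequency of visits to \<open>D\<close> to
  converge to its measure (\<open>besicovitch_xi\<close>).

  The lower bound for an open set \<open>U\<close> comes from translation invariance and compactness, without
  Fourier analysis.  Shrink \<open>U\<close> to the closed core of points that stay in \<open>U\<close> under translations
  from a small cube; this costs little measure.  Since the orbit is dense and the torus compact, for
  every \<open>s\<close> there is an \<open>m\<close> in a fixed bounded part of the lattice such that \<open>\<tau> m\<close> and \<open>s\<close> differ
  by an element of that cube.  Whenever \<open>s + \<tau> l\<close> is in the core, \<open>\<tau> (l + m)\<close> is in \<open>U\<close>; hence
  the visits of \<open>s + \<tau> l\<close> to the core are at most the visits of \<open>\<tau> l\<close> to \<open>U\<close>, up to a boundary
  term that is negligible uniformly in \<open>s\<close>.  Integrating over \<open>s\<close> replaces the former by the measure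
  of the core.

  It remains that the maps act on the two spaces and are continuous.  Every quasisturmian sequence
  is the sequence of the point \<open>0\<close> for a translated partition, so \<open>\<xi>\<close> is onto
  (\<open>quasisturmian_eq_image_xi\<close>).  The induced map on partitions is Lipschitz with constant
  \<open>card B\<close> (\<open>d_sym_induced_map_le\<close>).  The metric axioms for the Besicovitch distance and the
  continuity of the automaton are carried over by the similarity.
\<close>

section \<open>Boxes in the lattice\<close>

definition window :: "nat \<Rightarrow> (int ^ 'd) set"
  where "window N = {l. \<forall>i. - int N \<le> l $ i \<and> l $ i < int N}"

lemma window_eq_image: "window N = vec_lambda ` (UNIV \<rightarrow>\<^sub>E {- int N..<int N})"
proof (intro equalityI subsetI)
  fix l :: "int ^ 'd" assume "l \<in> window N"
  then have "vec_nth l \<in> UNIV \<rightarrow>\<^sub>E {- int N..<int N}"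
    by (auto simp: window_def)
  then show "l \<in> vec_lambda ` (UNIV \<rightarrow>\<^sub>E {- int N..<int N})"
    by (metis imageI vec_nth_inverse)
qed (auto simp: window_def Pi_iff PiE_UNIV_domain)

lemma finite_window [simp]: "finite (window N :: (int ^ 'd) set)"
  by (simp add: window_eq_image finite_PiE)

lemma card_window: "card (window N :: (int ^ 'd) set) = (2 * N) ^ CARD('d)"
proof -
  have "inj_on vec_lambda (UNIV \<rightarrow>\<^sub>E {- int N..<int N} :: ('d \<Rightarrow> int) set)"
    by (rule inj_onI) (metis vec_lambda_inverse UNIV_I)
  moreover have "nat (int N - - int N) = 2 * N"
    by simp
  ultimately show ?thesis
    by (simp only: window_eq_image card_image card_PiE[OF finite] card_atLeastLessThan_int prod_constant)
qed

lemma window_mono: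
  assumes "M \<le> N"
  shows "window M \<subseteq> window N"
proof
  fix l :: "int ^ 'd" assume "l \<in> window M"
  then have "- int M \<le> l $ i \<and> l $ i < int M" for i
    by (simp add: window_def)
  with assms have "- int N \<le> l $ i \<and> l $ i < int N" for i
    by (smt (verit) of_nat_le_iff)
  then show "l \<in> window N"
    by (simp add: window_def)
qed

text \<open>Moving a box by \<open>m\<close> keeps it inside a slightly larger box, so the number of points of a
  set seen through the box grows by at most the volume of the added shell.  The bound is written
  with both volumes added, to avoid subtraction of naturals.\<close>

lemma card_window_shift:
  fixes m :: "int ^ 'd"
  assumes "\<And>i. \<bar>m $ i\<bar> \<le> int M"
  shows "card {l \<in> window N. l + m \<in> S} + (2 * N) ^ CARD('d)
    \<le> card {l \<in> window N. l \<in> S} + (2 * (N + M)) ^ CARD('d)"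
proof -
  let ?W = "window N :: (int ^ 'd) set" and ?W' = "window (N + M) :: (int ^ 'd) set"
  have sub: "?W \<subseteq> ?W'"
    by (rule window_mono) simp
  have "l + m \<in> ?W'" if "l \<in> ?W" for l
  proof -
    have "- int (N + M) \<le> (l + m) $ i \<and> (l + m) $ i < int (N + M)" for i
      using that assms[of i] by (simp add: window_def) (smt (verit))
    then show ?thesis by (simp add: window_def)
  qed
  then have "(\<lambda>l. l + m) ` {l \<in> ?W. l + m \<in> S} \<subseteq> {l \<in> ?W. l \<in> S} \<union> (?W' - ?W)"
    by auto
  then have "card {l \<in> ?W. l + m \<in> S} \<le> card ({l \<in> ?W. l \<in> S} \<union> (?W' - ?W))"
    by (intro card_inj_on_le[of "\<lambda>l. l + m"]) (auto simp: inj_on_def)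
  also have "\<dots> \<le> card {l \<in> ?W. l \<in> S} + card (?W' - ?W)"
    by (rule card_Un_le)
  also have "card (?W' - ?W) = (2 * (N + M)) ^ CARD('d) - (2 * N) ^ CARD('d)"
    using sub by (simp only: card_Diff_subset finite_window card_window)
  finally have le: "card {l \<in> ?W. l + m \<in> S}
      \<le> card {l \<in> ?W. l \<in> S} + ((2 * (N + M)) ^ CARD('d) - (2 * N) ^ CARD('d))" .
  have "a + b \<le> x + c" if "a \<le> x + (c - b)" "b \<le> c" for a b c x :: nat
    using that by linarith
  moreover have "(2 * N) ^ CARD('d) \<le> (2 * (N + M)) ^ CARD('d)"
    by (rule power_mono) simp_all
  ultimately show ?thesis
    using le by blast
qed

text \<open>A shell of bounded width is negligible against the box: the boxes form a Folner
  sequence.\<close>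

lemma window_ratio_tendsto:
  "(\<lambda>N. real ((2 * (N + M)) ^ k) / (2 * real N) ^ k) \<longlonglongrightarrow> 1"
proof -
  have "(\<lambda>N. (1 + real M / real N) ^ k) \<longlonglongrightarrow> (1 + 0) ^ k"
    by (intro tendsto_intros lim_const_over_n)
  moreover have "\<forall>\<^sub>F N in sequentially.
      (1 + real M / real N) ^ k = real ((2 * (N + M)) ^ k) / (2 * real N) ^ k"
    using eventually_gt_at_top[of 0]
  proof eventually_elim
    case (elim N)
    then have "1 + real M / real N = real (2 * (N + M)) / (2 * real N)"
      by (simp add: field_simps)
    then show ?case
      by (simp only: power_divide of_nat_power)
  qed
  ultimately show ?thesis
    using Lim_transform_eventually by fastforce
qed


section \<open>Small neighbourhoods of zero in the torus\<close>

definition torus_cube :: "real \<Rightarrow> (circle ^ 'k) set"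
  where "torus_cube r = torus_of ` {y. \<forall>i. \<bar>y $ i\<bar> < r}"

lemma torus_of_minus: "torus_of (- y) = - torus_of y"
  by (simp add: torus_of_def vec_eq_iff uminus_circle.abs_eq)

lemma uminus_torus_cube: "w \<in> torus_cube r \<Longrightarrow> - w \<in> torus_cube r"
  unfolding torus_cube_def
  by (clarsimp simp: torus_of_minus[symmetric] intro!: imageI)

lemma torus_cube_mono: "r \<le> s \<Longrightarrow> torus_cube r \<subseteq> torus_cube s"
  unfolding torus_cube_def by (rule image_mono) (auto intro: less_le_trans)

lemma zero_in_torus_cube: "0 < r \<Longrightarrow> 0 \<in> torus_cube r"
  unfolding torus_cube_def
  by (rule image_eqI[of _ _ 0]) (auto simp: torus_of_def vec_eq_iff zero_circle_def)

lemma open_abs_circle_image: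
  assumes "open V"
  shows "open (abs_circle ` V)"
proof -
  have "abs_circle -` (abs_circle ` V) = (\<Union>n::int. (\<lambda>x. x + of_int n) -` V)"
  proof (intro equalityI subsetI)
    fix x assume "x \<in> abs_circle -` (abs_circle ` V)"
    then obtain y where y: "y \<in> V" "y - x \<in> \<int>"
      by (auto simp: abs_circle_eq_iff dest: sym)
    then obtain n where "y - x = of_int n"
      by (auto elim: Ints_cases)
    then show "x \<in> (\<Union>n::int. (\<lambda>x. x + of_int n) -` V)"
      using y(1) by (auto intro!: exI[of _ n] simp: algebra_simps)
  next
    fix x assume "x \<in> (\<Union>n::int. (\<lambda>x. x + of_int n) -` V)"
    then obtain n :: int where "x + of_int n \<in> V"
      by auto
    moreover have "abs_circle x = abs_circle (x + of_int n)"
      by (simp add: abs_circle_eq_iff)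
    ultimately show "x \<in> abs_circle -` (abs_circle ` V)"
      by auto
  qed
  moreover have "open \<dots>"
    by (intro open_UN ballI open_vimage[OF assms] continuous_intros)
  ultimately show ?thesis
    by (simp add: open_circle_def)
qed

lemma open_torus_cube: "open (torus_cube r :: (circle ^ 'k) set)"
proof -
  have "torus_cube r = (\<Inter>i\<in>UNIV. (\<lambda>t::circle ^ 'k. t $ i) -` abs_circle ` {- r<..<r})"
  proof (intro equalityI subsetI)
    fix t :: "circle ^ 'k"
    assume "t \<in> (\<Inter>i\<in>UNIV. (\<lambda>t. t $ i) -` abs_circle ` {- r<..<r})"
    then have "\<forall>i. \<exists>x. t $ i = abs_circle x \<and> \<bar>x\<bar> < r"
      by (force simp: image_iff abs_less_iff)
    then obtain y where "\<forall>i. t $ i = abs_circle (y i) \<and> \<bar>y i\<bar> < r"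
      by metis
    then have "t = torus_of (vec_lambda y)" "\<forall>i. \<bar>vec_lambda y $ i\<bar> < r"
      by (simp_all add: torus_of_def vec_eq_iff)
    then show "t \<in> torus_cube r"
      unfolding torus_cube_def by blast
  next
    fix t :: "circle ^ 'k"
    assume "t \<in> torus_cube r"
    then obtain y where "t = torus_of y" "\<And>i. \<bar>y $ i\<bar> < r"
      by (auto simp: torus_cube_def)
    then have "t $ i \<in> abs_circle ` {- r<..<r}" for i
      by (auto simp: torus_of_def abs_less_iff intro!: imageI) (smt (verit))+
    then show "t \<in> (\<Inter>i\<in>UNIV. (\<lambda>t. t $ i) -` abs_circle ` {- r<..<r})"
      by auto
  qed
  moreover have "open \<dots>"
    by (intro open_INT ballI open_vimage open_abs_circle_image) (auto intro: continuous_intros)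
  ultimately show ?thesis by simp
qed

lemma compact_torus: "compact (UNIV :: (circle ^ 'k) set)"
proof -
  have "t \<in> torus_of ` cbox 0 1" for t :: "circle ^ 'k"
  proof -
    obtain y where "t = torus_of y"
      using surj_torus_of by metis
    moreover obtain n where "y + lattice_point n \<in> unit_cube"
      using unit_cube_domain by blast
    moreover have "unit_cube \<subseteq> (cbox 0 1 :: (real ^ 'k) set)"
      by (auto simp: unit_cube_def mem_box_cart less_imp_le)
    ultimately show ?thesis
      by (metis imageI subsetD torus_of_lattice)
  qed
  then have "(UNIV :: (circle ^ 'k) set) = torus_of ` cbox 0 1"
    by blast
  moreover have "compact (torus_of ` cbox 0 (1 :: real ^ 'k))"
    by (rule compact_continuous_image)
      (use continuous_torus_of continuous_on_subset in \<open>auto intro: compact_cbox\<close>)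
  ultimately show ?thesis by simp
qed

text \<open>A dense orbit visits every translate of a small cube, and by compactness it does so within
  a bounded time: this is the uniformity in the starting point that makes rotations uniquely
  ergodic.\<close>

lemma dense_orbit_uniform_return:
  fixes \<tau> :: "int ^ 'd \<Rightarrow> circle ^ 'k"
  assumes dense: "closure (range \<tau>) = UNIV" and r: "0 < r"
  shows "\<exists>M. \<forall>s. \<exists>m. (\<forall>i. \<bar>m $ i\<bar> \<le> int M) \<and> s - \<tau> m \<in> torus_cube r"
proof -
  have op: "open ((\<lambda>t. t + (- \<tau> m)) -` torus_cube r)" for m
    by (rule open_vimage[OF open_torus_cube continuous_torus_add])
  have "\<exists>m. s + (- \<tau> m) \<in> torus_cube r" for s
  proof -
    have "open ((\<lambda>t. t + (- s)) -` torus_cube r)"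
      by (rule open_vimage[OF open_torus_cube continuous_torus_add])
    moreover have "s \<in> (\<lambda>t. t + (- s)) -` torus_cube r"
      using zero_in_torus_cube[OF r] by simp
    moreover have "s \<in> closure (range \<tau>)"
      using dense by simp
    ultimately obtain m where "\<tau> m + (- s) \<in> torus_cube r"
      using open_Int_closure_eq_empty[of "(\<lambda>t. t + (- s)) -` torus_cube r" "range \<tau>"] by blast
    then show ?thesis
      using uminus_torus_cube[of "\<tau> m + (- s)" r] by (intro exI[of _ m]) simp
  qed
  then have "UNIV \<subseteq> (\<Union>m\<in>UNIV. (\<lambda>t. t + (- \<tau> m)) -` torus_cube r)"
    by auto
  from compactE_image[OF compact_torus op this]
  obtain F where F: "finite F" "UNIV \<subseteq> (\<Union>m\<in>F. (\<lambda>t. t + (- \<tau> m)) -` torus_cube r)"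
    by metis
  let ?M = "\<Sum>m\<in>F. \<Sum>i\<in>UNIV. nat \<bar>m $ i\<bar>"
  have "\<exists>m. (\<forall>i. \<bar>m $ i\<bar> \<le> int ?M) \<and> s - \<tau> m \<in> torus_cube r" for s
  proof -
    obtain m where m: "m \<in> F" "s - \<tau> m \<in> torus_cube r"
      using F(2) by auto
    have "nat \<bar>m $ i\<bar> \<le> ?M" for i
    proof -
      have "nat \<bar>m $ i\<bar> \<le> (\<Sum>i\<in>UNIV. nat \<bar>m $ i\<bar>)"
        by (rule member_le_sum) auto
      also have "\<dots> \<le> ?M"
        using F(1) m(1) by (intro member_le_sum) auto
      finally show ?thesis .
    qed
    then have "\<bar>m $ i\<bar> \<le> int ?M" for i
      by (simp add: nat_le_iff)
    with m(2) show ?thesis by blast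
  qed
  then show ?thesis by blast
qed

text \<open>The core \<open>{t. \<forall>w\<in>torus_cube r. t + w \<in> U}\<close> is the part of \<open>U\<close> that stays in \<open>U\<close> under
  small translations.  Cores exhaust an open set, hence also its measure.\<close>

lemma closed_core:
  fixes U :: "(circle ^ 'k) set"
  shows "closed {t. \<forall>w\<in>torus_cube r. t + w \<in> U}"
proof -
  have "- {t. \<forall>w\<in>torus_cube r. t + w \<in> U} = (\<Union>u\<in>-U. (\<lambda>t. t + (- u)) -` torus_cube r)"
  proof (intro equalityI subsetI)
    fix t assume "t \<in> - {t. \<forall>w\<in>torus_cube r. t + w \<in> U}"
    then obtain w where "w \<in> torus_cube r" "t + w \<notin> U"
      by auto
    then show "t \<in> (\<Union>u\<in>-U. (\<lambda>t. t + (- u)) -` torus_cube r)"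
      using uminus_torus_cube[of w r] by (intro UN_I[of "t + w"]) auto
  next
    fix t assume "t \<in> (\<Union>u\<in>-U. (\<lambda>t. t + (- u)) -` torus_cube r)"
    then obtain u where "u \<notin> U" "t - u \<in> torus_cube r"
      by auto
    then show "t \<in> - {t. \<forall>w\<in>torus_cube r. t + w \<in> U}"
      using uminus_torus_cube[of "t - u" r] by (auto intro!: bexI[of _ "u - t"])
  qed
  moreover have "open \<dots>"
    by (intro open_UN ballI open_vimage[OF open_torus_cube continuous_torus_add])
  ultimately show ?thesis
    by (simp add: closed_def)
qed

lemma open_contains_torus_cube:
  fixes U :: "(circle ^ 'k) set"
  assumes "open U" "t \<in> U"
  shows "\<exists>r>0. \<forall>w\<in>torus_cube r. t + w \<in> U"
proof -
  obtain x where x: "t = torus_of x"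
    using surj_torus_of by metis
  have "open (torus_of -` U)"
    by (rule open_vimage[OF assms(1) continuous_torus_of])
  then obtain e where e: "e > 0" "ball x e \<subseteq> torus_of -` U"
    using assms(2) x open_contains_ball by (metis vimageI)
  \<comment> \<open>The norm is at most the sum of the coordinates, so this cube lies in the ball.\<close>
  let ?r = "e / (real CARD('k))"
  have "t + w \<in> U" if w: "w \<in> torus_cube ?r" for w
  proof -
    obtain y where y: "w = torus_of y" "\<forall>i. \<bar>y $ i\<bar> < ?r"
      using w unfolding torus_cube_def by blast
    have "norm y \<le> (\<Sum>i\<in>UNIV. \<bar>y $ i\<bar>)"
      by (rule norm_le_l1_cart)
    also have "\<dots> < (\<Sum>i\<in>(UNIV :: 'k set). ?r)"
      by (rule sum_strict_mono) (use y(2) in auto)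
    also have "\<dots> = e"
      by simp
    finally have "x + y \<in> ball x e"
      by (simp add: dist_norm)
    then show ?thesis
      using e(2) by (auto simp: x y(1) torus_of_add)
  qed
  then show ?thesis
    using e(1) by (intro exI[of _ ?r]) auto
qed

lemma measure_core_approximates:
  fixes U :: "(circle ^ 'k) set"
  assumes U: "open U" and e: "0 < e"
  shows "\<exists>r>0. measure haar U - e < measure haar {t. \<forall>w\<in>torus_cube r. t + w \<in> U}"
proof -
  define K where "K n = {t. \<forall>w\<in>torus_cube (1 / real (Suc n)). t + w \<in> U}" for n
  have "(\<Union>n. K n) = U"
  proof (intro equalityI subsetI)
    fix t assume "t \<in> (\<Union>n. K n)"
    then obtain n where "\<forall>w\<in>torus_cube (1 / real (Suc n)). t + w \<in> U"
      by (auto simp: K_def)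
    then show "t \<in> U"
      using zero_in_torus_cube[of "1 / real (Suc n)"] by (metis add.right_neutral of_nat_0_less_iff
          zero_less_Suc zero_less_divide_1_iff)
  next
    fix t assume "t \<in> U"
    then obtain r where r: "r > 0" "\<forall>w\<in>torus_cube r. t + w \<in> U"
      using open_contains_torus_cube[OF U] by blast
    obtain n where "1 / real (Suc n) < r"
      using nat_approx_posE[OF r(1)] by blast
    then have "t \<in> K n"
      using r(2) torus_cube_mono[of "1 / real (Suc n)" r] by (auto simp: K_def)
    then show "t \<in> (\<Union>n. K n)"
      by blast
  qed
  moreover have "range K \<subseteq> sets haar"
    unfolding K_def using closed_core by (auto intro: borel_closed)
  moreover have "incseq K"
  proof (rule incseq_SucI)
    fix n
    have "torus_cube (1 / real (Suc (Suc n))) \<subseteq> (torus_cube (1 / real (Suc n)) :: (circle ^ 'k) set)"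
      by (rule torus_cube_mono) (simp add: field_simps)
    then show "K n \<subseteq> K (Suc n)"
      by (auto simp: K_def)
  qed
  ultimately have "(\<lambda>n. measure haar (K n)) \<longlonglongrightarrow> measure haar U"
    using haar.finite_Lim_measure_incseq[of K] by simp
  then have "\<forall>\<^sub>F n in sequentially. measure haar U - e < measure haar (K n)"
    by (rule order_tendstoD) (use e in simp)
  then obtain n where "measure haar U - e < measure haar (K n)"
    by (metis eventually_sequentially order_refl)
  then show ?thesis
    by (intro exI[of _ "1 / real (Suc n)"]) (simp add: K_def)
qed


section \<open>Equidistribution of the orbit\<close>

text \<open>The sum of the measures is the integral over \<open>s\<close> of the number of sets that contain \<open>s\<close>,
  and the Haar measure is normalised.\<close>

lemma sum_measure_le_multiplicity:
  fixes A :: "'i \<Rightarrow> (circle ^ 'k) set"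
  assumes I: "finite I" and A: "\<And>i. i \<in> I \<Longrightarrow> A i \<in> sets borel"
    and c: "\<And>s. real (card {i \<in> I. s \<in> A i}) \<le> c"
  shows "(\<Sum>i\<in>I. measure haar (A i)) \<le> c"
proof -
  have int: "integrable haar (indicator (A i) :: _ \<Rightarrow> real)" if "i \<in> I" for i
    using A[OF that] by (intro integrable_real_indicator) (auto simp: less_top[symmetric])
  have "(\<Sum>i\<in>I. measure haar (A i)) = (\<Sum>i\<in>I. \<integral>s. indicator (A i) s \<partial>haar)"
    by simp
  also have "\<dots> = (\<integral>s. (\<Sum>i\<in>I. indicator (A i) s) \<partial>haar)"
    by (rule Bochner_Integration.integral_sum[symmetric]) (fact int)
  also have "\<dots> \<le> (\<integral>s. c \<partial>(haar :: (circle ^ 'k) measure))"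
  proof (rule integral_mono)
    fix s :: "circle ^ 'k"
    have "(\<Sum>i\<in>I. indicator (A i) s) = real (card {i \<in> I. s \<in> A i})"
      using I by (simp add: indicator_def sum.If_cases Int_def)
    then show "(\<Sum>i\<in>I. indicator (A i) s) \<le> c"
      using c[of s] by simp
  qed (use int in auto)
  also have "\<dots> = c"
    by (simp add: measure_haar_UNIV)
  finally show ?thesis .
qed

text \<open>For a single large box the orbit of \<open>0\<close> visits \<open>U\<close> almost as often as the orbit of any
  other point \<open>s\<close> visits the core of \<open>U\<close>: follow the first orbit for a bounded time until it is
  close to \<open>s\<close>.  Averaging over \<open>s\<close> turns the number of visits to the core into its measure, by
  translation invariance.\<close>

lemma visits_lower_bound:
  fixes \<tau> :: "int ^ 'd \<Rightarrow> circle ^ 'k"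
  assumes hom: "\<And>x y. \<tau> (x + y) = \<tau> x + \<tau> y"
    and M: "\<And>s. \<exists>m. (\<forall>i. \<bar>m $ i\<bar> \<le> int M) \<and> s - \<tau> m \<in> torus_cube r"
  shows "(2 * real N) ^ CARD('d) * measure haar {t. \<forall>w\<in>torus_cube r. t + w \<in> U}
    + (2 * real N) ^ CARD('d)
    \<le> real (card {l \<in> window N. \<tau> l \<in> U}) + real ((2 * (N + M)) ^ CARD('d))"
proof -
  let ?K = "{t. \<forall>w\<in>torus_cube r. t + w \<in> U}" and ?W = "window N :: (int ^ 'd) set"
  let ?c = "real (card {l \<in> ?W. \<tau> l \<in> U}) + real ((2 * (N + M)) ^ CARD('d))
    - (2 * real N) ^ CARD('d)"
  have K: "?K \<in> sets borel"
    using closed_core by (rule borel_closed)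
  have "(\<Sum>l\<in>?W. measure haar ((\<lambda>s. s + \<tau> l) -` ?K)) \<le> ?c"
  proof (rule sum_measure_le_multiplicity)
    show "(\<lambda>s. s + \<tau> l) -` ?K \<in> sets borel" for l
      using measurable_sets[OF borel_measurable_continuous_onI[OF continuous_torus_add] K] by simp
    fix s
    obtain m where m: "\<And>i. \<bar>m $ i\<bar> \<le> int M" "s - \<tau> m \<in> torus_cube r"
      using M by metis
    \<comment> \<open>The points \<open>\<tau> (l + m)\<close> and \<open>s + \<tau> l\<close> differ by an element of the cube.\<close>
    have "\<tau> (l + m) \<in> U" if "s + \<tau> l \<in> ?K" for l
    proof -
      have "s + \<tau> l + - (s - \<tau> m) \<in> U"
        using that uminus_torus_cube[OF m(2)] by blast
      then show ?thesis
        by (simp add: hom algebra_simps)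
    qed
    then have "card {l \<in> ?W. s \<in> (\<lambda>s. s + \<tau> l) -` ?K} \<le> card {l \<in> ?W. l + m \<in> \<tau> -` U}"
      by (intro card_mono) auto
    moreover have "card {l \<in> ?W. l + m \<in> \<tau> -` U} + (2 * N) ^ CARD('d)
        \<le> card {l \<in> ?W. l \<in> \<tau> -` U} + (2 * (N + M)) ^ CARD('d)"
      by (rule card_window_shift) (fact m(1))
    ultimately have "card {l \<in> ?W. s \<in> (\<lambda>s. s + \<tau> l) -` ?K} + (2 * N) ^ CARD('d)
        \<le> card {l \<in> ?W. \<tau> l \<in> U} + (2 * (N + M)) ^ CARD('d)"
      by simp
    then have "real (card {l \<in> ?W. s \<in> (\<lambda>s. s + \<tau> l) -` ?K} + (2 * N) ^ CARD('d))
        \<le> real (card {l \<in> ?W. \<tau> l \<in> U} + (2 * (N + M)) ^ CARD('d))"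
      by (simp only: of_nat_le_iff)
    then show "real (card {l \<in> ?W. s \<in> (\<lambda>s. s + \<tau> l) -` ?K}) \<le> ?c"
      by simp
  qed simp
  moreover have "measure haar ((\<lambda>s. s + \<tau> l) -` ?K) = measure haar ?K" for l
    using emeasure_haar_translate[OF K] by (simp add: measure_def)
  ultimately have "real (card ?W) * measure haar ?K \<le> ?c"
    by simp
  then show ?thesis
    by (simp add: card_window)
qed

text \<open>For a general open set only the lower bound holds: an open set containing the orbit can
  have small measure.\<close>

lemma visit_frequency_lower_bound:
  fixes \<tau> :: "int ^ 'd \<Rightarrow> circle ^ 'k"
  assumes hom: "\<And>x y. \<tau> (x + y) = \<tau> x + \<tau> y" and dense: "closure (range \<tau>) = UNIV"
    and U: "open U" and e: "0 < e"
  shows "\<forall>\<^sub>F N in sequentially.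
    measure haar U - e < real (card {l \<in> window N. \<tau> l \<in> U}) / (2 * real N) ^ CARD('d)"
proof -
  obtain r where r: "r > 0"
    "measure haar U - e / 2 < measure haar {t. \<forall>w\<in>torus_cube r. t + w \<in> U}"
    using measure_core_approximates[OF U, of "e / 2"] e by auto
  obtain M where M: "\<And>s. \<exists>m. (\<forall>i. \<bar>m $ i\<bar> \<le> int M) \<and> s - \<tau> m \<in> torus_cube r"
    using dense_orbit_uniform_return[OF dense r(1)] by blast
  have "\<forall>\<^sub>F N in sequentially. real ((2 * (N + M)) ^ CARD('d)) / (2 * real N) ^ CARD('d) < 1 + e / 2"
    by (rule order_tendstoD[OF window_ratio_tendsto]) (use e in simp)
  then show ?thesis
    using eventually_gt_at_top[of 0]
  proof eventually_elim
    case (elim N)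
    let ?v = "(2 * real N) ^ CARD('d)"
    have v: "?v > 0"
      using elim by simp
    have "measure haar {t. \<forall>w\<in>torus_cube r. t + w \<in> U} + 1
        \<le> (real (card {l \<in> window N. \<tau> l \<in> U}) + real ((2 * (N + M)) ^ CARD('d))) / ?v"
      using visits_lower_bound[where \<tau> = \<tau> and N = N and U = U, OF hom M] v
      by (subst pos_le_divide_eq) (auto simp: algebra_simps)
    then show ?case
      using elim r(2) by (simp add: add_divide_distrib)
  qed
qed


section \<open>The Besicovitch distance of two itineraries\<close>

definition agreement :: "('a \<Rightarrow> 't set) \<Rightarrow> ('a \<Rightarrow> 't set) \<Rightarrow> 't set"
  where "agreement P Q = (\<Union>a. P a \<inter> Q a)"

definition disagreement :: "('a \<Rightarrow> 't set) \<Rightarrow> ('a \<Rightarrow> 't set) \<Rightarrow> 't set"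
  where "disagreement P Q = (\<Union>a. \<Union>b\<in>- {a}. P a \<inter> Q b)"

lemma open_agreement:
  "P \<in> open_partitions \<Longrightarrow> Q \<in> open_partitions \<Longrightarrow> open (agreement P Q)"
  unfolding agreement_def open_partitions_def by (intro open_UN ballI open_Int) auto

lemma open_disagreement:
  "P \<in> open_partitions \<Longrightarrow> Q \<in> open_partitions \<Longrightarrow> open (disagreement P Q)"
  unfolding disagreement_def open_partitions_def by (intro open_UN ballI open_Int) auto

lemma agreement_disagreement_disjoint:
  assumes "P \<in> open_partitions" "Q \<in> open_partitions"
  shows "agreement P Q \<inter> disagreement P Q = {}"
  using assms by (auto simp: agreement_def disagreement_def dest: open_partition_unique)

text \<open>Both sets are open and together they have full measure.  This is what replaces a
  regularity assumption on the boundaries: for two open sets that are complementary up to a null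
  set and that the orbit does not leave, lower bounds for the visit frequencies are also upper
  bounds.\<close>

lemma measure_agreement_disagreement:
  assumes P: "P \<in> open_partitions" and Q: "Q \<in> open_partitions"
  shows "measure haar (agreement P Q) + measure haar (disagreement P Q) = 1"
proof -
  have op: "open (\<Union>a. P a)" "open (\<Union>a. Q a)"
    using P Q by (auto simp: open_partitions_def)
  have null: "measure haar (- (\<Union>a. R a)) = 0" if "R \<in> open_partitions"
    for R :: "'a \<Rightarrow> (circle ^ 'b) set"
    using that haar.finite_measure_compl[of "\<Union>a. R a"]
    by (simp add: open_partitions_def Compl_eq_Diff_UNIV measure_haar_UNIV borel_open open_UN)
  have "agreement P Q \<union> disagreement P Q = (\<Union>a. P a) \<inter> (\<Union>a. Q a)"
    by (fastforce simp: agreement_def disagreement_def)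
  then have "- (agreement P Q \<union> disagreement P Q) = - (\<Union>a. P a) \<union> - (\<Union>a. Q a)"
    by (simp only: Compl_Int)
  then have "measure haar (- (agreement P Q \<union> disagreement P Q))
      \<le> measure haar (- (\<Union>a. P a)) + measure haar (- (\<Union>a. Q a))"
    using op by (simp only:) (rule measure_Un_le; simp del: Compl_UN add: borel_open borel_comp)
  then have "measure haar (- (agreement P Q \<union> disagreement P Q)) = 0"
    using null[OF P] null[OF Q] measure_nonneg[of haar "- (agreement P Q \<union> disagreement P Q)"]
    by linarith
  moreover have "measure haar (- (agreement P Q \<union> disagreement P Q))
      = 1 - measure haar (agreement P Q \<union> disagreement P Q)"
    using haar.finite_measure_compl[of "agreement P Q \<union> disagreement P Q"]
      open_agreement[OF P Q] open_disagreement[OF P Q]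
    by (simp add: Compl_eq_Diff_UNIV[symmetric] measure_haar_UNIV borel_open)
  moreover have "measure haar (agreement P Q \<union> disagreement P Q)
      = measure haar (agreement P Q) + measure haar (disagreement P Q)"
    using open_agreement[OF P Q] open_disagreement[OF P Q] agreement_disagreement_disjoint[OF P Q]
    by (intro haar.finite_measure_Union) (auto intro: borel_open)
  ultimately show ?thesis by simp
qed

text \<open>The factor 2 arises because a point of \<open>P a \<inter> Q b\<close> with \<open>a \<noteq> b\<close> lies in the symmetric
  differences for \<open>a\<close> and for \<open>b\<close>.\<close>

lemma d_sym_eq_disagreement:
  fixes P Q :: "'a::finite \<Rightarrow> (circle ^ 'k) set"
  assumes P: "P \<in> open_partitions" and Q: "Q \<in> open_partitions"
  shows "d_sym P Q = 2 * measure haar (disagreement P Q)"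
proof -
  have total: "(\<Sum>a\<in>UNIV. measure haar (R a)) = measure haar (\<Union>a. R a)"
    if "\<And>a. open (R a)" "disjoint_family R" for R :: "'a \<Rightarrow> (circle ^ 'k) set"
    using that by (intro haar.finite_measure_finite_Union[symmetric])
      (auto simp: disjoint_family_on_def intro: borel_open)
  have "measure haar (sym_diff (P a) (Q a))
      = measure haar (P a) + measure haar (Q a) - 2 * measure haar (P a \<inter> Q a)" for a
  proof -
    note [measurable] = open_partition_borel[OF P, of a] open_partition_borel[OF Q, of a]
    have "measure haar (sym_diff (P a) (Q a)) = measure haar (P a - Q a) + measure haar (Q a - P a)"
      by (rule haar.finite_measure_Union) auto
    then show ?thesis
      using haar.finite_measure_Diff'[of "P a" "Q a"] haar.finite_measure_Diff'[of "Q a" "P a"]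
      by (simp add: Int_commute)
  qed
  then have "d_sym P Q = (\<Sum>a\<in>UNIV. measure haar (P a)) + (\<Sum>a\<in>UNIV. measure haar (Q a))
      - 2 * (\<Sum>a\<in>UNIV. measure haar (P a \<inter> Q a))"
    by (simp add: d_sym_def sum.distrib sum_subtractf sum_distrib_left)
  also have "(\<Sum>a\<in>UNIV. measure haar (P a \<inter> Q a)) = measure haar (agreement P Q)"
    unfolding agreement_def using P Q
    by (intro total) (fastforce simp: open_partitions_def disjoint_family_on_def)+
  also have "(\<Sum>a\<in>UNIV. measure haar (P a)) = 1"
    using P total[of P] by (simp add: open_partitions_def)
  also have "(\<Sum>a\<in>UNIV. measure haar (Q a)) = 1"
    using Q total[of Q] by (simp add: open_partitions_def)
  finally show ?thesis
    using measure_agreement_disagreement[OF P Q] by simp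
qed

lemma pointed_partitions_iff:
  assumes "\<And>x y. \<tau> (x + y) = \<tau> x + \<tau> y"
  shows "P \<in> pointed_partitions \<tau> \<longleftrightarrow> P \<in> open_partitions \<and> (\<forall>l. \<exists>a. \<tau> l \<in> P a)"
  using generic_points_iff[of \<tau> 0 P, OF assms] by (simp add: pointed_partitions_def)

lemma xi_eqI: "P \<in> open_partitions \<Longrightarrow> \<tau> l \<in> P a \<Longrightarrow> xi \<tau> P l = a"
  unfolding xi_def by (rule itinerary_eqI) simp_all

lemma orbit_in_cell_iff:
  assumes hom: "\<And>x y. \<tau> (x + y) = \<tau> x + \<tau> y" and P: "P \<in> pointed_partitions \<tau>"
  shows "\<tau> l \<in> P a \<longleftrightarrow> xi \<tau> P l = a"
proof -
  have PO: "P \<in> open_partitions" and "\<exists>a. \<tau> l \<in> P a"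
    using P pointed_partitions_iff[of \<tau> P, OF hom] by blast+
  then show ?thesis
    using xi_eqI[OF PO, of \<tau> l] by blast
qed

text \<open>The orbit of \<open>0\<close> stays in the union of the two sets, so their visit frequencies add up
  to 1.  Each is asymptotically at least the measure of its set, and the measures add up to 1
  too; hence both frequencies converge to the measures.\<close>

lemma besicovitch_xi:
  fixes \<tau> :: "int ^ 'd \<Rightarrow> circle ^ 'k" and P Q :: "'a::finite \<Rightarrow> (circle ^ 'k) set"
  assumes hom: "\<And>x y. \<tau> (x + y) = \<tau> x + \<tau> y" and dense: "closure (range \<tau>) = UNIV"
    and P: "P \<in> pointed_partitions \<tau>" and Q: "Q \<in> pointed_partitions \<tau>"
  shows "besicovitch (xi \<tau> P) (xi \<tau> Q) = measure haar (disagreement P Q)"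
proof -
  have PO: "P \<in> open_partitions" and QO: "Q \<in> open_partitions"
    using P Q by (auto simp: pointed_partitions_def)
  let ?A = "agreement P Q" and ?D = "disagreement P Q"
  let ?f = "\<lambda>U N. real (card {l \<in> window N. \<tau> l \<in> U}) / (2 * real N) ^ CARD('d)"
  have D: "\<tau> l \<in> ?D \<longleftrightarrow> xi \<tau> P l \<noteq> xi \<tau> Q l" for l
    by (auto simp: disagreement_def orbit_in_cell_iff[of \<tau>, OF hom P] orbit_in_cell_iff[of \<tau>, OF hom Q])
  have A: "\<tau> l \<in> ?A \<longleftrightarrow> xi \<tau> P l = xi \<tau> Q l" for l
    by (auto simp: agreement_def orbit_in_cell_iff[of \<tau>, OF hom P] orbit_in_cell_iff[of \<tau>, OF hom Q])
  have compl: "?f ?D N = 1 - ?f ?A N" if "N > 0" for N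
  proof -
    have "card {l \<in> window N. \<tau> l \<in> ?D} + card {l \<in> window N. \<tau> l \<in> ?A}
        = card ({l \<in> window N. \<tau> l \<in> ?D} \<union> {l \<in> window N. \<tau> l \<in> ?A})"
      by (rule card_Un_disjoint[symmetric]) (auto simp: A D)
    also have "{l \<in> window N. \<tau> l \<in> ?D} \<union> {l \<in> window N. \<tau> l \<in> ?A} = (window N :: (int ^ 'd) set)"
      by (auto simp: A D)
    finally have "card {l \<in> window N. \<tau> l \<in> ?D} + card {l \<in> window N. \<tau> l \<in> ?A}
        = (2 * N) ^ CARD('d)"
      by (simp add: card_window)
    then have sum: "real (card {l \<in> window N. \<tau> l \<in> ?D}) + real (card {l \<in> window N. \<tau> l \<in> ?A})
        = (2 * real N) ^ CARD('d)"
      by (simp only: of_nat_add[symmetric]) (simp only: of_nat_power of_nat_mult of_nat_numeral)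
    have "x / v = 1 - y / v" if "x + y = v" "0 < v" for x y v :: real
      using that by (simp add: field_simps)
    from this[OF sum] show ?thesis
      using \<open>N > 0\<close> by simp
  qed
  have "?f ?D \<longlonglongrightarrow> measure haar ?D"
  proof (rule tendstoI)
    fix e :: real assume e: "0 < e"
    show "\<forall>\<^sub>F N in sequentially. dist (?f ?D N) (measure haar ?D) < e"
      using visit_frequency_lower_bound[where \<tau> = \<tau>, OF hom dense open_disagreement[OF PO QO] e]
        visit_frequency_lower_bound[where \<tau> = \<tau>, OF hom dense open_agreement[OF PO QO] e]
        eventually_gt_at_top[of 0]
    proof eventually_elim
      case (elim N)
      then show ?case
        using compl[of N] measure_agreement_disagreement[OF PO QO]
        unfolding dist_real_def by linarith
    qed
  qed
  then have "(\<lambda>N. ereal (?f ?D N)) \<longlonglongrightarrow> ereal (measure haar ?D)"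
    by (simp add: tendsto_ereal)
  then have "limsup (\<lambda>N. ereal (?f ?D N)) = ereal (measure haar ?D)"
    by (rule lim_imp_Limsup[OF trivial_limit_sequentially])
  then show ?thesis
    by (simp add: besicovitch_def D window_def)
qed

lemma besicovitch_nonneg: "0 \<le> besicovitch p q"
  unfolding besicovitch_def
  by (intro real_of_ereal_pos le_Limsup) (auto intro!: always_eventually)

lemma besicovitch_commute: "besicovitch p q = besicovitch q p"
  unfolding besicovitch_def by (simp add: eq_commute)


section \<open>Partitions and sequences in correspondence\<close>

text \<open>Density of the union comes for free, because nonempty open sets have positive measure.\<close>

lemma open_partitionsI:
  assumes op: "\<And>a. open (P a)" and disj: "disjoint_family P"
    and m: "measure haar (\<Union>a. P a) = 1"
  shows "P \<in> open_partitions"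
proof -
  let ?W = "- closure (\<Union>a. P a)"
  have U: "open (\<Union>a. P a)"
    using op by auto
  have "measure haar ?W \<le> measure haar (- (\<Union>a. P a))"
    by (rule haar.finite_measure_mono)
      (use closure_subset[of "\<Union>a. P a"] U in \<open>auto simp del: Compl_UN intro: borel_comp borel_open\<close>)
  also have "\<dots> = 0"
    using haar.finite_measure_compl[of "\<Union>a. P a"] m U
    by (simp add: Compl_eq_Diff_UNIV measure_haar_UNIV borel_open)
  finally have "measure haar ?W = 0"
    by (simp add: measure_le_0_iff)
  then have "emeasure haar ?W = 0"
    by (simp add: haar.emeasure_eq_measure)
  then have "?W = {}"
    using emeasure_haar_open_pos[of ?W] open_Compl[OF closed_closure] by blast
  then show ?thesis
    using op disj m by (auto simp: open_partitions_def)
qed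

text \<open>Translating the partition moves any generic base point to \<open>0\<close>.\<close>

lemma quasisturmian_eq_image_xi:
  fixes \<tau> :: "int ^ 'd \<Rightarrow> circle ^ 'k"
  assumes hom: "\<And>x y. \<tau> (x + y) = \<tau> x + \<tau> y"
  shows "quasisturmian \<tau> = xi \<tau> ` pointed_partitions \<tau>"
proof (intro equalityI subsetI)
  fix p :: "int ^ 'd \<Rightarrow> 'a" assume "p \<in> quasisturmian \<tau>"
  then obtain P t where p: "p = itinerary \<tau> P t" and P: "P \<in> open_partitions"
    and t: "t \<in> generic_points \<tau> P"
    unfolding quasisturmian_def by blast
  define Q where "Q a = (\<lambda>s. s + t) -` P a" for a
  have orbit: "\<tau> l \<in> Q (p l)" for l
  proof -
    obtain a where "t + \<tau> l \<in> P a"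
      using t generic_points_iff[of \<tau> t P, OF hom] by blast
    then show ?thesis
      using itinerary_eqI[OF P, of t \<tau> l a] by (simp add: p Q_def add.commute)
  qed
  have QO: "Q \<in> open_partitions"
  proof (rule open_partitionsI)
    show "open (Q a)" for a
      unfolding Q_def using P
      by (intro open_vimage continuous_torus_add) (simp add: open_partitions_def)
    show "disjoint_family Q"
      using open_partition_unique[OF P] by (auto simp: disjoint_family_on_def Q_def)
    have "(\<Union>a. P a) \<in> sets borel"
      using open_partition_borel[OF P] by auto
    then have "measure haar ((\<lambda>s. s + t) -` (\<Union>a. P a)) = measure haar (\<Union>a. P a)"
      by (simp only: measure_def emeasure_haar_translate)
    then show "measure haar (\<Union>a. Q a) = 1"
      using P by (simp add: Q_def vimage_UN[symmetric] open_partitions_def)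
  qed
  with orbit have "Q \<in> pointed_partitions \<tau>"
    using pointed_partitions_iff[of \<tau> Q, OF hom] by blast
  moreover have "p = xi \<tau> Q"
    by (rule ext) (rule xi_eqI[OF QO orbit, symmetric])
  ultimately show "p \<in> xi \<tau> ` pointed_partitions \<tau>"
    by blast
qed (auto simp: quasisturmian_def xi_def pointed_partitions_def)

lemma xi_induced_map:
  fixes \<tau> :: "int ^ 'd \<Rightarrow> circle ^ 'k" and P :: "'a::finite \<Rightarrow> (circle ^ 'k) set"
  assumes hom: "\<And>x y. \<tau> (x + y) = \<tau> x + \<tau> y" and B: "finite B"
    and P: "P \<in> pointed_partitions \<tau>"
  shows "induced_map \<tau> B \<phi> P \<in> pointed_partitions \<tau>"
    and "xi \<tau> (induced_map \<tau> B \<phi> P) = cellular_automaton B \<phi> (xi \<tau> P)"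
proof -
  have PO: "P \<in> open_partitions"
    using P by (simp add: pointed_partitions_def)
  have IO: "induced_map \<tau> B \<phi> P \<in> open_partitions"
    by (rule induced_map_open_partition) fact+
  have cell: "\<tau> l \<in> induced_map \<tau> B \<phi> P (cellular_automaton B \<phi> (xi \<tau> P) l)" for l
    unfolding induced_map_iff[of \<tau>, OF hom] cellular_automaton_def
    by (intro bexI[of _ "\<lambda>b\<in>B. xi \<tau> P (l + b)"])
      (auto simp: hom[symmetric] orbit_in_cell_iff[of \<tau>, OF hom P])
  show "induced_map \<tau> B \<phi> P \<in> pointed_partitions \<tau>"
    using IO cell pointed_partitions_iff[of \<tau>, OF hom] by blast
  show "xi \<tau> (induced_map \<tau> B \<phi> P) = cellular_automaton B \<phi> (xi \<tau> P)"
    by (rule ext) (rule xi_eqI[OF IO cell])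
qed

text \<open>The images can disagree at \<open>t\<close> only if the partitions disagree at one of the finitely many
  points \<open>t + \<tau> b\<close> that the local map reads.\<close>

lemma d_sym_induced_map_le:
  fixes \<tau> :: "int ^ 'd \<Rightarrow> circle ^ 'k" and P Q :: "'a::finite \<Rightarrow> (circle ^ 'k) set"
  assumes hom: "\<And>x y. \<tau> (x + y) = \<tau> x + \<tau> y" and B: "finite B"
    and P: "P \<in> open_partitions" and Q: "Q \<in> open_partitions"
  shows "d_sym (induced_map \<tau> B \<phi> P) (induced_map \<tau> B \<phi> Q) \<le> real (card B) * d_sym P Q"
proof -
  let ?P = "induced_map \<tau> B \<phi> P" and ?Q = "induced_map \<tau> B \<phi> Q"
  have IP: "?P \<in> open_partitions" by (rule induced_map_open_partition) fact+
  have IQ: "?Q \<in> open_partitions" by (rule induced_map_open_partition) fact+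
  have D: "disagreement P Q \<in> sets borel"
    using open_disagreement[OF P Q] by (rule borel_open)
  have V: "(\<lambda>t. t + \<tau> b) -` disagreement P Q \<in> sets borel" for b
    using measurable_sets[OF borel_measurable_continuous_onI[OF continuous_torus_add] D] by simp
  have sub: "disagreement ?P ?Q \<subseteq> (\<Union>b\<in>B. (\<lambda>t. t + \<tau> b) -` disagreement P Q)"
  proof
    fix t assume "t \<in> disagreement ?P ?Q"
    then obtain a a' where "a \<noteq> a'" "t \<in> ?P a" "t \<in> ?Q a'"
      unfolding disagreement_def UN_iff by (elim bexE IntE) (rule that; simp)
    obtain c where c: "c \<in> B \<rightarrow>\<^sub>E UNIV" "\<phi> c = a" "\<forall>b\<in>B. t + \<tau> b \<in> P (c b)"
      using \<open>t \<in> ?P a\<close> unfolding induced_map_iff[of \<tau>, OF hom] by blast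
    obtain c' where c': "c' \<in> B \<rightarrow>\<^sub>E UNIV" "\<phi> c' = a'" "\<forall>b\<in>B. t + \<tau> b \<in> Q (c' b)"
      using \<open>t \<in> ?Q a'\<close> unfolding induced_map_iff[of \<tau>, OF hom] by blast
    have "c \<noteq> c'"
      using \<open>a \<noteq> a'\<close> c(2) c'(2) by blast
    then obtain b where b: "b \<in> B" "c b \<noteq> c' b"
      using PiE_ext[OF c(1) c'(1)] by blast
    have "t + \<tau> b \<in> P (c b) \<inter> Q (c' b)" "c' b \<in> - {c b}"
      using b c(3) c'(3) by auto
    then have "t + \<tau> b \<in> disagreement P Q"
      unfolding disagreement_def by blast
    with b(1) show "t \<in> (\<Union>b\<in>B. (\<lambda>t. t + \<tau> b) -` disagreement P Q)"
      by blast
  qed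
  have "measure haar (disagreement ?P ?Q)
      \<le> measure haar (\<Union>b\<in>B. (\<lambda>t. t + \<tau> b) -` disagreement P Q)"
    by (rule haar.finite_measure_mono[OF sub]) (use B V in auto)
  also have "\<dots> \<le> (\<Sum>b\<in>B. measure haar ((\<lambda>t. t + \<tau> b) -` disagreement P Q))"
    by (rule haar.finite_measure_subadditive_finite) (use B V in auto)
  also have "\<dots> = real (card B) * measure haar (disagreement P Q)"
    using emeasure_haar_translate[OF D] by (simp add: measure_def)
  finally show ?thesis
    by (simp add: d_sym_eq_disagreement[OF P Q] d_sym_eq_disagreement[OF IP IQ])
qed


section \<open>Lipschitz maps and similarities of metric spaces\<close>

lemma continuous_map_if_Lipschitz:
  assumes X: "Metric_space X d" and Y: "Metric_space Y e" and f: "f ` X \<subseteq> Y"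
    and lip: "\<And>x y. x \<in> X \<Longrightarrow> y \<in> X \<Longrightarrow> e (f x) (f y) \<le> K * d x y"
  shows "continuous_map (Metric_space.mtopology X d) (Metric_space.mtopology Y e) f"
  unfolding Metric_space.metric_continuous_map[OF X Y]
proof (intro conjI ballI allI impI f)
  fix x and r :: real assume x: "x \<in> X" and r: "0 < r"
  interpret Metric_space X d by (fact X)
  show "\<exists>\<delta>>0. \<forall>y. y \<in> X \<and> d x y < \<delta> \<longrightarrow> e (f x) (f y) < r"
  proof (intro exI conjI allI impI)
    show "0 < r / (\<bar>K\<bar> + 1)"
      using r by simp
    fix y assume y: "y \<in> X \<and> d x y < r / (\<bar>K\<bar> + 1)"
    have "e (f x) (f y) \<le> K * d x y"
      using lip x y by blast
    also have "\<dots> \<le> (\<bar>K\<bar> + 1) * d x y"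
      by (intro mult_right_mono) auto
    also have "\<dots> < r"
      using y by (simp add: pos_less_divide_eq mult.commute)
    finally show "e (f x) (f y) < r" .
  qed
qed

text \<open>Nonnegativity and symmetry are demanded at all arguments, because \<^locale>\<open>Metric_space\<close>
  asks for them outside the carrier too, where a similarity says nothing.\<close>

lemma Metric_space_similar_image:
  assumes X: "Metric_space X d" and img: "h ` X = Y" and c: "0 < c"
    and sim: "\<And>x y. x \<in> X \<Longrightarrow> y \<in> X \<Longrightarrow> e (h x) (h y) = c * d x y"
    and nonneg: "\<And>p q. 0 \<le> e p q" and comm: "\<And>p q. e p q = e q p"
  shows "Metric_space Y e"
proof
  interpret X: Metric_space X d by (fact X)
  show "0 \<le> e p q" for p q by (fact nonneg)
  show "e p q = e q p" for p q by (fact comm)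
  fix p q assume "p \<in> Y" "q \<in> Y"
  then obtain x y where x: "x \<in> X" "p = h x" and y: "y \<in> X" "q = h y"
    using img by blast
  have "h x = h y \<Longrightarrow> x = y"
    using sim[of x y] sim[of y y] x y c by simp
  then show "e p q = 0 \<longleftrightarrow> p = q"
    using sim[of x y] x y c by auto
  fix r assume "r \<in> Y"
  then obtain z where z: "z \<in> X" "r = h z"
    using img by blast
  show "e p r \<le> e p q + e q r"
    using X.triangle[of x y z] x y z c by (simp add: sim flip: distrib_left)
qed

text \<open>A similarity is injective, and both it and its inverse are Lipschitz.\<close>

lemma homeomorphic_map_similarity:
  assumes X: "Metric_space X d" and Y: "Metric_space Y e" and img: "h ` X = Y" and c: "0 < c"
    and sim: "\<And>x y. x \<in> X \<Longrightarrow> y \<in> X \<Longrightarrow> e (h x) (h y) = c * d x y"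
  shows "homeomorphic_map (Metric_space.mtopology X d) (Metric_space.mtopology Y e) h"
proof -
  interpret X: Metric_space X d by (fact X)
  interpret Y: Metric_space Y e by (fact Y)
  have inj: "inj_on h X"
  proof (rule inj_onI)
    fix x y assume xy: "x \<in> X" "y \<in> X" "h x = h y"
    then have "e (h x) (h y) = 0"
      using img by auto
    then show "x = y"
      using sim[of x y] xy c by simp
  qed
  let ?g = "inv_into X h"
  have g: "?g p \<in> X" "h (?g p) = p" if "p \<in> Y" for p
    using that img by (auto intro: inv_into_into f_inv_into_f)
  have "continuous_map X.mtopology Y.mtopology h"
    by (rule continuous_map_if_Lipschitz[OF X Y, of _ c]) (use img sim in auto)
  moreover have "continuous_map Y.mtopology X.mtopology ?g"
  proof (rule continuous_map_if_Lipschitz[OF Y X, of _ "1 / c"])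
    show "d (?g p) (?g q) \<le> 1 / c * e p q" if "p \<in> Y" "q \<in> Y" for p q
      using sim[of "?g p" "?g q"] g[OF that(1)] g[OF that(2)] c by (simp add: field_simps)
  qed (use g in auto)
  ultimately have "homeomorphic_maps X.mtopology Y.mtopology h ?g"
    using g inj by (simp add: homeomorphic_maps_def)
  then show ?thesis
    by (rule homeomorphic_maps_imp_map)
qed


section \<open>The isomorphism\<close>

lemma pointed_classes_eq:
  "pointed_classes \<tau> = (\<lambda>P. part_equiv `` {P}) ` pointed_partitions \<tau>"
proof (intro equalityI subsetI)
  fix C :: "('a \<Rightarrow> (circle ^ 'b) set) set"
  assume "C \<in> pointed_classes \<tau>"
  then obtain P where C: "C \<in> open_partitions // part_equiv" and P: "P \<in> C" "P \<in> pointed_partitions \<tau>"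
    by (auto simp: pointed_classes_def)
  then have "C = part_equiv `` {P}"
    using equiv_part_equiv by (metis Image_singleton_iff equiv_class_eq quotientE)
  with P(2) show "C \<in> (\<lambda>P. part_equiv `` {P}) ` pointed_partitions \<tau>"
    by blast
next
  fix C :: "('a \<Rightarrow> (circle ^ 'b) set) set"
  assume "C \<in> (\<lambda>P. part_equiv `` {P}) ` pointed_partitions \<tau>"
  then obtain P where P: "P \<in> pointed_partitions \<tau>" "C = part_equiv `` {P}"
    by blast
  then show "C \<in> pointed_classes \<tau>"
    using equiv_class_self[OF equiv_part_equiv, of P]
    by (auto simp: pointed_classes_def pointed_partitions_def intro: quotientI)
qed

lemma Metric_space_pointed_classes:
  fixes \<tau> :: "int ^ 'd \<Rightarrow> circle ^ 'k"
  shows "Metric_space (pointed_classes \<tau> :: ('a::finite \<Rightarrow> (circle ^ 'k) set) set set) d_class"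
proof
  show "0 \<le> d_class C D" "d_class C D = d_class D C"
    for C D :: "('a \<Rightarrow> (circle ^ 'k) set) set"
    by (simp_all add: d_class_def d_sym_nonneg d_sym_sym)
  fix C D :: "('a \<Rightarrow> (circle ^ 'k) set) set"
  assume "C \<in> pointed_classes \<tau>" "D \<in> pointed_classes \<tau>"
  then obtain P Q where P: "P \<in> open_partitions" "C = part_equiv `` {P}"
    and Q: "Q \<in> open_partitions" "D = part_equiv `` {Q}"
    by (auto simp: pointed_classes_eq pointed_partitions_def)
  have "C = D \<longleftrightarrow> (P, Q) \<in> part_equiv"
    using P Q eq_equiv_class_iff[OF equiv_part_equiv] by blast
  then show "d_class C D = 0 \<longleftrightarrow> C = D"
    using P(1) Q(1) by (simp only: P(2) Q(2) d_sym_class) (simp add: part_equiv_def)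
  fix E :: "('a \<Rightarrow> (circle ^ 'k) set) set"
  assume "E \<in> pointed_classes \<tau>"
  then obtain R where R: "R \<in> open_partitions" "E = part_equiv `` {R}"
    by (auto simp: pointed_classes_eq pointed_partitions_def)
  show "d_class C E \<le> d_class C D + d_class D E"
    using P Q R by (simp add: d_sym_class d_sym_triangle)
qed

theorem proposition3p5:
  fixes \<tau> :: "int ^ 'd \<Rightarrow> circle ^ 'k"
    and B :: "(int ^ 'd) set"
    and \<phi> :: "(int ^ 'd \<Rightarrow> 'a::finite) \<Rightarrow> 'a"
    and \<Phi> :: "(int ^ 'd \<Rightarrow> 'a) \<Rightarrow> (int ^ 'd \<Rightarrow> 'a)"
  assumes "\<And>x y. \<tau> (x + y) = \<tau> x + \<tau> y"
    and "inj \<tau>"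
    and "closure (range \<tau>) = UNIV"
    and "finite B"
    and "\<Phi> = cellular_automaton B \<phi>"
  shows "(\<forall>P\<in>pointed_partitions \<tau>.
            induced_map \<tau> B \<phi> P \<in> pointed_partitions \<tau> \<and>
            xi \<tau> (induced_map \<tau> B \<phi> P) = \<Phi> (xi \<tau> P)) \<and>
         \<Phi> ` quasisturmian \<tau> \<subseteq> quasisturmian \<tau> \<and>
         dynamical_isomorphism
           (pointed_classes \<tau>) d_class (induced_class \<tau> B \<phi>)
           (quasisturmian \<tau>) besicovitch \<Phi>
           (xi_class \<tau>)"
proof (intro conjI)
  note hom = assms(1) and dense = assms(3) and B = assms(4) and \<Phi> = assms(5)
  let ?O = "pointed_partitions \<tau> :: ('a \<Rightarrow> (circle ^ 'k) set) set"
  let ?X = "pointed_classes \<tau> :: ('a \<Rightarrow> (circle ^ 'k) set) set set"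
  let ?Y = "quasisturmian \<tau> :: (int ^ 'd \<Rightarrow> 'a) set"
  let ?cl = "\<lambda>P :: 'a \<Rightarrow> (circle ^ 'k) set. part_equiv `` {P}"
  let ?F = "induced_class \<tau> B \<phi>"
  have PO: "P \<in> open_partitions" if "P \<in> ?O" for P
    using that by (simp add: pointed_partitions_def)
  have ind: "induced_map \<tau> B \<phi> P \<in> ?O" "xi \<tau> (induced_map \<tau> B \<phi> P) = \<Phi> (xi \<tau> P)" if "P \<in> ?O" for P
    using xi_induced_map[of \<tau> B P \<phi>] hom B that by (simp_all add: \<Phi>)
  show "\<forall>P\<in>?O. induced_map \<tau> B \<phi> P \<in> ?O \<and> xi \<tau> (induced_map \<tau> B \<phi> P) = \<Phi> (xi \<tau> P)"
    using ind by blast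
  have Y: "?Y = xi \<tau> ` ?O"
    by (rule quasisturmian_eq_image_xi) (fact hom)
  show inv: "\<Phi> ` ?Y \<subseteq> ?Y"
  proof (rule image_subsetI)
    fix p assume "p \<in> ?Y"
    then obtain P where P: "P \<in> ?O" "p = xi \<tau> P"
      unfolding Y by blast
    have "\<Phi> p = xi \<tau> (induced_map \<tau> B \<phi> P)"
      by (simp only: P(2) ind(2)[OF P(1)])
    then show "\<Phi> p \<in> ?Y"
      unfolding Y using ind(1)[OF P(1)] by (rule image_eqI)
  qed
  have xi_cl: "xi_class \<tau> (?cl P) = xi \<tau> P" if "P \<in> ?O" for P
    by (rule xi_class) (fact hom that)+
  have F_cl: "?F (?cl P) = ?cl (induced_map \<tau> B \<phi> P)" if "P \<in> ?O" for P
    by (rule induced_map_class) (use hom B PO that in auto)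
  have img: "xi_class \<tau> ` ?X = ?Y"
    by (simp add: pointed_classes_eq Y image_image xi_cl)
  have sim: "besicovitch (xi_class \<tau> C) (xi_class \<tau> D) = 1 / 2 * d_class C D"
    if CD: "C \<in> ?X" "D \<in> ?X" for C D
  proof -
    obtain P Q where P: "P \<in> ?O" "C = ?cl P" and Q: "Q \<in> ?O" "D = ?cl Q"
      using CD unfolding pointed_classes_eq by blast
    show ?thesis
      using besicovitch_xi[of \<tau>, OF hom dense P(1) Q(1)] PO[OF P(1)] PO[OF Q(1)]
      by (simp add: P Q xi_cl d_sym_class d_sym_eq_disagreement)
  qed
  have mX: "Metric_space ?X d_class"
    by (rule Metric_space_pointed_classes)
  have mY: "Metric_space ?Y besicovitch"
    by (rule Metric_space_similar_image[where c = "1 / 2", OF mX img])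
      (simp_all add: sim besicovitch_nonneg besicovitch_commute)
  have F_img: "?F ` ?X \<subseteq> ?X"
    unfolding pointed_classes_eq using F_cl ind(1) by auto
  have F_lip: "d_class (?F C) (?F D) \<le> real (card B) * d_class C D" if CD: "C \<in> ?X" "D \<in> ?X" for C D
  proof -
    obtain P Q where P: "P \<in> ?O" "C = ?cl P" and Q: "Q \<in> ?O" "D = ?cl Q"
      using CD unfolding pointed_classes_eq by blast
    show ?thesis
      using d_sym_induced_map_le[of \<tau>, OF hom B PO[OF P(1)] PO[OF Q(1)]]
      by (simp add: P Q F_cl d_sym_class PO ind(1))
  qed
  have conj: "xi_class \<tau> (?F C) = \<Phi> (xi_class \<tau> C)" if C: "C \<in> ?X" for C
  proof -
    obtain P where P: "P \<in> ?O" "C = ?cl P"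
      using C unfolding pointed_classes_eq by blast
    then show ?thesis
      by (simp add: F_cl xi_cl ind)
  qed
  \<comment> \<open>Lipschitz continuity of \<open>\<Phi>\<close> is transported from the partitions along the similarity.\<close>
  have \<Phi>_lip: "besicovitch (\<Phi> p) (\<Phi> q) \<le> real (card B) * besicovitch p q"
    if pq: "p \<in> ?Y" "q \<in> ?Y" for p q
  proof -
    obtain C D where C: "C \<in> ?X" "p = xi_class \<tau> C" and D: "D \<in> ?X" "q = xi_class \<tau> D"
      using pq unfolding img[symmetric] by blast
    have FC: "?F C \<in> ?X" "?F D \<in> ?X"
      using F_img C(1) D(1) by auto
    have "besicovitch (\<Phi> p) (\<Phi> q) = 1 / 2 * d_class (?F C) (?F D)"
      by (simp only: sim[OF FC, symmetric] conj[OF C(1)] conj[OF D(1)] C(2) D(2))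
    also have "\<dots> \<le> 1 / 2 * (real (card B) * d_class C D)"
      by (rule mult_left_mono[OF F_lip[OF C(1) D(1)]]) simp
    also have "\<dots> = real (card B) * besicovitch p q"
      by (simp add: sim[OF C(1) D(1)] C(2) D(2))
    finally show ?thesis .
  qed
  show "dynamical_isomorphism ?X d_class ?F ?Y besicovitch \<Phi> (xi_class \<tau>)"
    unfolding dynamical_isomorphism_def dynamical_system_def
  proof (intro conjI ballI mX mY conj)
    show "continuous_map (Metric_space.mtopology ?X d_class) (Metric_space.mtopology ?X d_class) ?F"
      by (rule continuous_map_if_Lipschitz[where K = "real (card B)", OF mX mX F_img]) (fact F_lip)
    show "continuous_map (Metric_space.mtopology ?Y besicovitch)
        (Metric_space.mtopology ?Y besicovitch) \<Phi>"
      by (rule continuous_map_if_Lipschitz[where K = "real (card B)", OF mY mY inv]) (fact \<Phi>_lip)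
    show "homeomorphic_map (Metric_space.mtopology ?X d_class)
        (Metric_space.mtopology ?Y besicovitch) (xi_class \<tau>)"
      by (rule homeomorphic_map_similarity[where c = "1 / 2", OF mX mY img]) (simp_all add: sim)
  qed
qed

end
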